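(* Let $K$ be a field, let $k>2$ be an integer and let $n_1,\dots,n_k$ be positive integers. Let $L=L_k(n_1,\dots,n_k)$ be the Crystal lattice, $R=K[L]$ the polynomial ring whose variables are the elements of $L$, $I_L\subset R$ the join-meet ideal of $L$, and $\mathrm{in}_{\prec}(I_L)$ its initial ideal with respect to the reverse lexicographic order $\prec$ described in the context. Then $$\max\{n_1,\dots,n_k\}\;\le\;\mathrm{pd}_R\big(R/\mathrm{in}_{\prec}(I_L)\big)\;\le\; n_1+\cdots+n_k+2,$$ and for every $i=1,2,\dots,n_1$, $$\binom{n_1}{i}\;\le\;\sum_{j=0}^{\infty}B_{i,j}(n_1,\dots,n_k),$$ where $B_{i,j}(n_1,\dots,n_k)$ are the graded Betti numbers of the $R$-module $R/\mathrm{in}_{\prec}(I_L)$ (so the right-hand side is its $i$-th total Betti number).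
   Context: For positive integers $n_1,\dots,n_k$, the Crystal lattice $L_k(n_1,\dots,n_k)$ is the finite lattice $\{s,x_{1,1},\dots,x_{1,n_1},\dots,x_{k,1},\dots,x_{k,n_k},t\}$ (all listed elements distinct) whose order relations are exactly those generated by $s<x_{i,1}<x_{i,2}<\cdots<x_{i,n_i}<t$ for $1\le i\le k$; for $i\neq j$, elements $x_{i,r}$ and $x_{j,q}$ are incomparable, with join $t$ and meet $s$. For a finite lattice $L$, $K[L]$ is the polynomial ring over $K$ whose variables are the elements of $L$, and the join-meet ideal of $L$ is $$I_L=\big(\{ab-(a\vee b)(a\wedge b)\mid a,b\in L\}\big)\subset K[L].$$ The monomial order $\prec$ on $K[L]$ is the (graded) reverse lexicographic order induced by the ordering of variables $$s\prec x_{1,1}\prec\cdots\prec x_{1,n_1}\prec x_{2,1}\prec\cdots\prec x_{2,n_2}\prec\cdots\prec x_{k,1}\prec\cdots\prec x_{k,n_k}\prec t,$$ that is, $u\prec v$ for monomials $u\ne v$ if $\deg u<\deg v$, or if $\deg u=\deg v$ and, for the smallest variable whose exponents in $u$ and $v$ differ, its exponent in $u$ is larger than its exponent in $v$. The initial ideal $\mathrm{in}_{\prec}(I_L)$ is the ideal generated by the $\prec$-largest monomials of the nonzero elements of $I_L$. With $R=K[L]$ standard graded, the minimal graded free resolution of $R/\mathrm{in}_{\prec}(I_L)$ has $i$-th term $\bigoplus_j R(-j)^{B_{i,j}(n_1,\dots,n_k)}$ (with $0$-th term $R$); $\mathrm{pd}_R$ denotes its length, the projective dimension. *)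

theory Defs
  imports
    "HOL-Library.Poly_Mapping"
    "HOL-Library.Extended_Nat"
    "HOL-Algebra.Lattice"
    "HOL-Algebra.Ideal"
    "Jordan_Normal_Form.Matrix_Kernel"
begin

section \<open>Polynomial rings\<close>

text \<open>
  Monomials are finitely supported exponent functions and polynomials are finitely supported
  coefficient functions on monomials. The type of variables may be infinite; the polynomial ring
  on a set \<open>V\<close> of variables is cut out by its carrier.
\<close>

type_synonym 'v monomial = "'v \<Rightarrow>\<^sub>0 nat"
type_synonym ('v, 'a) mpoly = "('v \<Rightarrow>\<^sub>0 nat) \<Rightarrow>\<^sub>0 'a"

definition poly_vars :: "('v, 'a::zero) mpoly \<Rightarrow> 'v set" where
  "poly_vars p = (\<Union>m\<in>Poly_Mapping.keys p. Poly_Mapping.keys m)"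

definition poly_ring :: "'v set \<Rightarrow> ('v, 'a::field) mpoly ring" where
  "poly_ring V = \<lparr>carrier = {p. poly_vars p \<subseteq> V}, mult = (*), one = 1, zero = 0, add = (+)\<rparr>"

definition var :: "'v \<Rightarrow> ('v, 'a::field) mpoly" where
  "var x = Poly_Mapping.single (Poly_Mapping.single x 1) 1"

definition mdeg :: "'v monomial \<Rightarrow> nat" where
  "mdeg m = (\<Sum>x\<in>Poly_Mapping.keys m. Poly_Mapping.lookup m x)"

lemma poly_vars_add: "poly_vars (p + q) \<subseteq> poly_vars p \<union> poly_vars q"
  unfolding poly_vars_def using Poly_Mapping.keys_add[of p q] by blast

lemma poly_vars_mult:
  fixes p q :: "('v, 'a::field) mpoly"
  shows "poly_vars (p * q) \<subseteq> poly_vars p \<union> poly_vars q"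
proof
  fix x assume "x \<in> poly_vars (p * q)"
  then obtain m where m: "m \<in> Poly_Mapping.keys (p * q)" "x \<in> Poly_Mapping.keys m"
    by (auto simp: poly_vars_def)
  then obtain a b where "m = a + b" "a \<in> Poly_Mapping.keys p" "b \<in> Poly_Mapping.keys q"
    using keys_mult[of p q] by blast
  with m(2) Poly_Mapping.keys_add[of a b] show "x \<in> poly_vars p \<union> poly_vars q"
    unfolding poly_vars_def by blast
qed

lemma cring_poly_ring: "cring (poly_ring V :: ('v, 'a::field) mpoly ring)"
proof (rule cringI)
  show "abelian_group (poly_ring V :: ('v, 'a) mpoly ring)"
  proof (rule abelian_groupI)
    fix x y :: "('v, 'a) mpoly"
    assume x: "x \<in> carrier (poly_ring V)"
    then show "\<exists>y\<in>carrier (poly_ring V). y \<oplus>\<^bsub>poly_ring V\<^esub> x = \<zero>\<^bsub>poly_ring V\<^esub>"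
      by (intro bexI[of _ "- x"]) (auto simp: poly_ring_def poly_vars_def)
    assume "y \<in> carrier (poly_ring V)"
    with x show "x \<oplus>\<^bsub>poly_ring V\<^esub> y \<in> carrier (poly_ring V)"
      using poly_vars_add[of x y] by (auto simp: poly_ring_def)
  qed (simp_all add: poly_ring_def poly_vars_def ac_simps)
  show "Group.comm_monoid (poly_ring V :: ('v, 'a) mpoly ring)"
  proof (rule comm_monoidI)
    fix x y :: "('v, 'a) mpoly"
    assume "x \<in> carrier (poly_ring V)" "y \<in> carrier (poly_ring V)"
    then show "x \<otimes>\<^bsub>poly_ring V\<^esub> y \<in> carrier (poly_ring V)"
      using poly_vars_mult[of x y] by (auto simp: poly_ring_def)
  qed (simp_all add: poly_ring_def poly_vars_def ac_simps)
qed (simp add: poly_ring_def distrib_right)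

section \<open>Join-meet ideals and initial ideals\<close>

definition join_meet_ideal :: "('v, 'm) gorder_scheme \<Rightarrow> ('v, 'a::field) mpoly set" where
  "join_meet_ideal L =
     genideal (poly_ring (carrier L))
       {var a * var b - var (a \<squnion>\<^bsub>L\<^esub> b) * var (a \<sqinter>\<^bsub>L\<^esub> b) | a b. a \<in> carrier L \<and> b \<in> carrier L}"

text \<open>\<open>lt x y\<close> is the strict order of the variables.\<close>

definition revlex_less :: "('v \<Rightarrow> 'v \<Rightarrow> bool) \<Rightarrow> 'v monomial \<Rightarrow> 'v monomial \<Rightarrow> bool" where
  "revlex_less lt u v \<longleftrightarrow>
     mdeg u < mdeg v \<or>
     mdeg u = mdeg v \<and>
       (\<exists>x. Poly_Mapping.lookup u x > Poly_Mapping.lookup v x \<and>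
            (\<forall>y. lt y x \<longrightarrow> Poly_Mapping.lookup u y = Poly_Mapping.lookup v y))"

definition is_initial_monomial ::
    "('v monomial \<Rightarrow> 'v monomial \<Rightarrow> bool) \<Rightarrow> ('v, 'a::field) mpoly \<Rightarrow> 'v monomial \<Rightarrow> bool" where
  "is_initial_monomial prec p u \<longleftrightarrow>
     u \<in> Poly_Mapping.keys p \<and> (\<forall>v\<in>Poly_Mapping.keys p. v \<noteq> u \<longrightarrow> prec v u)"

definition initial_ideal ::
    "'v set \<Rightarrow> ('v monomial \<Rightarrow> 'v monomial \<Rightarrow> bool) \<Rightarrow> ('v, 'a::field) mpoly set \<Rightarrow> ('v, 'a) mpoly set" where
  "initial_ideal V prec I =
     genideal (poly_ring V) {Poly_Mapping.single u 1 | u. \<exists>p\<in>I. p \<noteq> 0 \<and> is_initial_monomial prec p u}"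

section \<open>Minimal graded free resolutions of cyclic modules\<close>

text \<open>
  A complex \<open>\<dots> \<rightarrow> F\<^sub>2 \<rightarrow> F\<^sub>1 \<rightarrow> F\<^sub>0\<close> of finitely generated graded free modules, with chosen bases.
  \<open>shifts F i\<close> lists the degrees \<open>j\<close> of the basis elements of the \<open>i\<close>-th term, which
  is therefore the direct sum of the \<open>R(-j)\<close>; \<open>boundary F i\<close> is the matrix
  of the map from the term \<open>i + 1\<close> to the term \<open>i\<close>, acting on column vectors.
\<close>

record 'p free_complex =
  shifts :: "nat \<Rightarrow> nat list"
  boundary :: "nat \<Rightarrow> 'p mat"

definition free_module :: "'v set \<Rightarrow> nat \<Rightarrow> ('v, 'a::field) mpoly vec set" where
  "free_module V r = {w \<in> carrier_vec r. \<forall>i<r. w $ i \<in> carrier (poly_ring V)}"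

text \<open>
  The last condition says that the boundary maps preserve degree: the entry in row \<open>r\<close>
  and column \<open>c\<close> is zero or homogeneous of degree (shift of \<open>c\<close>) - (shift of \<open>r\<close>).
\<close>

definition graded_free_maps :: "'v set \<Rightarrow> ('v, 'a::field) mpoly free_complex \<Rightarrow> bool" where
  "graded_free_maps V F \<longleftrightarrow>
     (\<forall>i. boundary F i \<in> carrier_mat (length (shifts F i)) (length (shifts F (Suc i)))) \<and>
     (\<forall>i. \<forall>r<length (shifts F i). \<forall>c<length (shifts F (Suc i)).
        boundary F i $$ (r, c) \<in> carrier (poly_ring V) \<and>
        (\<forall>m\<in>Poly_Mapping.keys (boundary F i $$ (r, c)).
            mdeg m + shifts F i ! r = shifts F (Suc i) ! c))"

text \<open>
  \<open>F\<close> resolves \<open>R/J\<close>, where \<open>R\<close> is the polynomial ring on \<open>V\<close>: the term in position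
  \<open>0\<close> is \<open>R\<close>, augmented by the projection \<open>R \<rightarrow> R/J\<close>, whose kernel is \<open>J\<close>.
\<close>

definition graded_free_resolution ::
    "'v set \<Rightarrow> ('v, 'a::field) mpoly set \<Rightarrow> ('v, 'a) mpoly free_complex \<Rightarrow> bool" where
  "graded_free_resolution V J F \<longleftrightarrow>
     graded_free_maps V F \<and>
     shifts F 0 = [0] \<and>
     {(boundary F 0 *\<^sub>v w) $ 0 | w. w \<in> free_module V (length (shifts F 1))} = J \<and>
     (\<forall>i. mat_kernel (boundary F i) \<inter> free_module V (length (shifts F (Suc i))) =
          {boundary F (Suc i) *\<^sub>v w | w. w \<in> free_module V (length (shifts F (Suc (Suc i))))})"

text \<open>
  Minimality: the image of each boundary map lies in \<open>\<mm>F\<^sub>i\<close>, where \<open>\<mm>\<close> is the ideal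
  generated by the variables; that is, the matrix entries have no constant term.
\<close>

definition minimal_graded_free_resolution ::
    "'v set \<Rightarrow> ('v, 'a::field) mpoly set \<Rightarrow> ('v, 'a) mpoly free_complex \<Rightarrow> bool" where
  "minimal_graded_free_resolution V J F \<longleftrightarrow>
     graded_free_resolution V J F \<and>
     (\<forall>i. \<forall>r<length (shifts F i). \<forall>c<length (shifts F (Suc i)).
        Poly_Mapping.lookup (boundary F i $$ (r, c)) 0 = 0)"

text \<open>
  The minimal graded free resolution of \<open>R/J\<close> exists for each proper homogeneous ideal \<open>J\<close> when
  \<open>V\<close> is finite, and it is unique up to isomorphism, so that its shifts and length do
  not depend on the choice.
\<close>

definition the_resolution :: "'v set \<Rightarrow> ('v, 'a::field) mpoly set \<Rightarrow> ('v, 'a) mpoly free_complex" where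
  "the_resolution V J = (SOME F. minimal_graded_free_resolution V J F)"

definition graded_betti :: "'v set \<Rightarrow> ('v, 'a::field) mpoly set \<Rightarrow> nat \<Rightarrow> nat \<Rightarrow> nat" where
  "graded_betti V J i j = count_list (shifts (the_resolution V J) i) j"

definition proj_dim :: "'v set \<Rightarrow> ('v, 'a::field) mpoly set \<Rightarrow> enat" where
  "proj_dim V J = Sup {enat i | i. shifts (the_resolution V J) i \<noteq> []}"

section \<open>The Crystal lattice\<close>

text \<open>\<open>Cx i r\<close> is the \<open>r\<close>-th element of the \<open>i\<close>-th chain; both indices start from \<open>1\<close>.\<close>

datatype crystal_elt = Cs | Cx nat nat | Ct

fun crystal_le :: "crystal_elt \<Rightarrow> crystal_elt \<Rightarrow> bool" where
  "crystal_le Cs _ = True"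
| "crystal_le _ Ct = True"
| "crystal_le (Cx i r) (Cx j q) = (i = j \<and> r \<le> q)"
| "crystal_le _ _ = False"

definition crystal_lattice :: "nat \<Rightarrow> (nat \<Rightarrow> nat) \<Rightarrow> crystal_elt gorder" where
  "crystal_lattice k n =
     \<lparr>carrier = {Cs, Ct} \<union> {Cx i r | i r. i \<in> {1..k} \<and> r \<in> {1..n i}}, eq = (=), le = crystal_le\<rparr>"

text \<open>The order of the variables, a linear extension of the lattice order.\<close>

fun crystal_var_less :: "crystal_elt \<Rightarrow> crystal_elt \<Rightarrow> bool" where
  "crystal_var_less Cs y = (y \<noteq> Cs)"
| "crystal_var_less (Cx i r) (Cx j q) = (i < j \<or> i = j \<and> r < q)"
| "crystal_var_less (Cx i r) Ct = True"
| "crystal_var_less _ _ = False"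

lemma crystal_le_refl: "crystal_le a a"
  by (cases a) auto

lemma crystal_le_trans: "crystal_le a b \<Longrightarrow> crystal_le b c \<Longrightarrow> crystal_le a c"
  by (cases a; cases b; cases c) auto

lemma crystal_le_antisym: "crystal_le a b \<Longrightarrow> crystal_le b a \<Longrightarrow> a = b"
  by (cases a; cases b) auto

lemma partial_order_crystal_lattice: "partial_order (crystal_lattice k n)"
  by unfold_locales
    (auto simp: crystal_lattice_def crystal_le_refl intro: crystal_le_trans crystal_le_antisym)

lemma crystal_le_Cx: "crystal_le (Cx i r) b \<longleftrightarrow> b = Ct \<or> (\<exists>q\<ge>r. b = Cx i q)"
  "crystal_le b (Cx i r) \<longleftrightarrow> b = Cs \<or> (\<exists>q\<le>r. b = Cx i q)"
  by (cases b; auto)+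

lemma incomparable_chain_elements:
  assumes "\<not> crystal_le x y" "\<not> crystal_le y x"
  obtains i r j q where "x = Cx i r" "y = Cx j q" "i \<noteq> j"
  using assms by (cases x; cases y; simp) (metis nle_le)

lemma crystal_least_Upper_iff:
  fixes k :: nat and n :: "nat \<Rightarrow> nat"
  defines "C \<equiv> carrier (crystal_lattice k n)"
  assumes "x \<in> C" "y \<in> C"
  shows "least (crystal_lattice k n) s (Upper (crystal_lattice k n) {x, y}) \<longleftrightarrow>
    s \<in> C \<and> crystal_le x s \<and> crystal_le y s \<and>
    (\<forall>z\<in>C. crystal_le x z \<and> crystal_le y z \<longrightarrow> crystal_le s z)"
proof -
  have le: "le (crystal_lattice k n) = crystal_le" by (simp add: crystal_lattice_def)
  show ?thesis
    using assms(2,3) unfolding least_def Upper_def le C_def[symmetric] by blast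
qed

lemma crystal_greatest_Lower_iff:
  fixes k :: nat and n :: "nat \<Rightarrow> nat"
  defines "C \<equiv> carrier (crystal_lattice k n)"
  assumes "x \<in> C" "y \<in> C"
  shows "greatest (crystal_lattice k n) s (Lower (crystal_lattice k n) {x, y}) \<longleftrightarrow>
    s \<in> C \<and> crystal_le s x \<and> crystal_le s y \<and>
    (\<forall>z\<in>C. crystal_le z x \<and> crystal_le z y \<longrightarrow> crystal_le z s)"
proof -
  have le: "le (crystal_lattice k n) = crystal_le" by (simp add: crystal_lattice_def)
  show ?thesis
    using assms(2,3) unfolding greatest_def Lower_def le C_def[symmetric] by blast
qed

lemma crystal_extrema_in_carrier:
  "Cs \<in> carrier (crystal_lattice k n)" "Ct \<in> carrier (crystal_lattice k n)"
  by (simp_all add: crystal_lattice_def)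

lemma lattice_crystal_lattice: "lattice (crystal_lattice k n)"
proof -
  interpret partial_order "crystal_lattice k n" by (rule partial_order_crystal_lattice)
  show ?thesis
  proof unfold_locales
    fix x y
    assume xy: "x \<in> carrier (crystal_lattice k n)" "y \<in> carrier (crystal_lattice k n)"
    note iffs = crystal_least_Upper_iff[OF xy] crystal_greatest_Lower_iff[OF xy]
    consider "crystal_le x y" | "crystal_le y x"
      | i r j q where "x = Cx i r" "y = Cx j q" "i \<noteq> j"
      using incomparable_chain_elements by metis
    then have "(\<exists>s. least (crystal_lattice k n) s (Upper (crystal_lattice k n) {x, y})) \<and>
      (\<exists>s. greatest (crystal_lattice k n) s (Lower (crystal_lattice k n) {x, y}))"
    proof cases
      case 1
      with xy show ?thesis unfolding iffs using crystal_le_refl by blast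
    next
      case 2
      with xy show ?thesis unfolding iffs using crystal_le_refl by blast
    next
      case 3
      then show ?thesis unfolding iffs
        by (intro conjI exI[of _ Ct] exI[of _ Cs])
          (auto simp: crystal_le_Cx crystal_extrema_in_carrier)
    qed
    then show "\<exists>s. least (crystal_lattice k n) s (Upper (crystal_lattice k n) {x, y})"
      and "\<exists>s. greatest (crystal_lattice k n) s (Lower (crystal_lattice k n) {x, y})"
      by blast+
  qed
qed

lemma crystal_join_meet:
  assumes "Cx i r \<in> carrier (crystal_lattice k n)" "Cx j q \<in> carrier (crystal_lattice k n)" "i \<noteq> j"
  shows "Cx i r \<squnion>\<^bsub>crystal_lattice k n\<^esub> Cx j q = Ct"
    and "Cx i r \<sqinter>\<^bsub>crystal_lattice k n\<^esub> Cx j q = Cs"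
proof -
  interpret lattice "crystal_lattice k n" by (rule lattice_crystal_lattice)
  have "least (crystal_lattice k n) Ct (Upper (crystal_lattice k n) {Cx i r, Cx j q})"
    unfolding crystal_least_Upper_iff[OF assms(1,2)]
    using assms(3) by (auto simp: crystal_le_Cx crystal_extrema_in_carrier)
  then show "Cx i r \<squnion>\<^bsub>crystal_lattice k n\<^esub> Cx j q = Ct"
    unfolding join_def sup_def by (rule some_equality) (blast intro: least_unique \<open>least _ Ct _\<close>)
  have "greatest (crystal_lattice k n) Cs (Lower (crystal_lattice k n) {Cx i r, Cx j q})"
    unfolding crystal_greatest_Lower_iff[OF assms(1,2)]
    using assms(3) by (auto simp: crystal_le_Cx crystal_extrema_in_carrier)
  then show "Cx i r \<sqinter>\<^bsub>crystal_lattice k n\<^esub> Cx j q = Cs"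
    unfolding meet_def inf_def by (rule some_equality) (blast intro: greatest_unique \<open>greatest _ Cs _\<close>)
qed

end

theory Submission
  imports Defs
begin

text \<open>
  The initial ideal \<open>J\<close> is a monomial ideal whose monomials all have degree at least 2, and it contains
  the products of variables from different chains; no Groebner basis is needed beyond this. For a
  minimal resolution \<open>F\<close> of \<open>R/J\<close>, diagram chases in the double complex of \<open>F\<close> and the Koszul complex show
  that \<open>F\<close> stops at the number of variables, and that the rank of its \<open>i\<close>-th term is at least the number of
  Koszul \<open>i\<close>-cycles of \<open>R/J\<close> that are independent modulo boundaries. If \<open>y\<close> is a variable of another
  chain, the cycles \<open>y e\<^sub>S\<close> for the \<open>i\<close>-element subsets \<open>S\<close> of a chain with \<open>n\<close> elements are independent, which
  gives the binomial bounds and, for \<open>i = n\<close>, the lower bound on the projective dimension. That a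
  minimal resolution exists follows from Dickson's lemma, by choosing homogeneous generating sets of
  minimal cardinality for the successive kernels.
\<close>

section \<open>Polynomials\<close>

text \<open>Behind the bounds is the balance of Tor(R/J, K), which has dimension rank F_i on the
  side of a minimal resolution F. No homology is constructed: a Koszul cycle modulo J is pushed
  along a staircase of explicit chains into F_i, and the constant terms of the coordinates at its
  end, a vector over K with rank F_i entries, stand for its class. The lower bound rests on
  injectivity alone: if these constant terms vanish, the cycle is a boundary modulo J. With more
  cycles than rank F_i, linear algebra yields a nontrivial combination that is a boundary. The
  factor y is there because e_S is not a cycle: its boundary has the coefficients x in S up to sign,
  and y moves them into J. The cycle then has linear coefficients while J starts in degree 2, so
  linear terms of boundaries come from chains with constant coefficients alone, which makes
  independence visible. The statement speaks of a resolution picked by \<open>SOME\<close>, about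
  which nothing is known before existence is shown. The estimates are then derived for an arbitrary
  minimal resolution.\<close>

definition polys :: "'v set \<Rightarrow> ('v, 'a::field) mpoly set" where
  "polys V = {p. poly_vars p \<subseteq> V}"

lemma carrier_poly_ring [simp]: "carrier (poly_ring V) = polys V"
  by (simp add: poly_ring_def polys_def)

lemma polys_iff: "p \<in> polys V \<longleftrightarrow> (\<forall>m\<in>Poly_Mapping.keys p. Poly_Mapping.keys m \<subseteq> V)"
  by (auto simp: polys_def poly_vars_def)

lemma polys_0 [simp]: "0 \<in> polys V" and polys_1 [simp]: "1 \<in> polys V"
  by (auto simp: polys_iff)

lemma polys_add [intro]: "p \<in> polys V \<Longrightarrow> q \<in> polys V \<Longrightarrow> p + q \<in> polys V"
  using poly_vars_add[of p q] by (auto simp: polys_def)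

lemma polys_mult [intro]: "p \<in> polys V \<Longrightarrow> q \<in> polys V \<Longrightarrow> p * q \<in> polys V"
  using poly_vars_mult[of p q] by (auto simp: polys_def)

lemma polys_uminus [intro]: "p \<in> polys V \<Longrightarrow> - p \<in> polys V"
  by (auto simp: polys_iff)

lemma polys_diff [intro]: "p \<in> polys V \<Longrightarrow> q \<in> polys V \<Longrightarrow> p - q \<in> polys V"
  using polys_add[of p V "- q"] by auto

lemma polys_sum [intro]: "(\<And>i. i \<in> A \<Longrightarrow> f i \<in> polys V) \<Longrightarrow> sum f A \<in> polys V"
  by (induction A rule: infinite_finite_induct) auto

lemma polys_single [intro]: "Poly_Mapping.keys m \<subseteq> V \<Longrightarrow> Poly_Mapping.single m c \<in> polys V"
  by (auto simp: polys_iff split: if_splits)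

lemma polys_const [simp]: "Poly_Mapping.single 0 c \<in> polys V"
  by (rule polys_single) simp

lemma polys_var [intro]: "x \<in> V \<Longrightarrow> var x \<in> polys V"
  unfolding var_def by (rule polys_single) simp

lemma keys_single_mult:
  "Poly_Mapping.keys (Poly_Mapping.single u c * p) \<subseteq> {u + m | m. m \<in> Poly_Mapping.keys p}"
  using keys_mult[of "Poly_Mapping.single u c" p] by (auto split: if_splits)

lemma lookup_single_mult:
  fixes p :: "('v, 'a::field) mpoly"
  shows "Poly_Mapping.lookup (Poly_Mapping.single u c * p) (u + m) = c * Poly_Mapping.lookup p m"
  by (simp add: lookup_mult lookup_single when_mult)

lemma lookup_mult_0:
  fixes p q :: "('v, 'a::field) mpoly"
  shows "Poly_Mapping.lookup (p * q) 0 = Poly_Mapping.lookup p 0 * Poly_Mapping.lookup q 0"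
proof -
  have *: "(0::'v monomial) = l + k \<longleftrightarrow> l = 0 \<and> k = 0" for l k
    by (auto simp: poly_mapping_eq_iff fun_eq_iff lookup_add)
  have "(\<Sum>k. Poly_Mapping.lookup q k when (0::'v monomial) = l + k) = (Poly_Mapping.lookup q 0 when l = 0)" for l
    by (cases "l = 0") (simp_all add: *)
  then show ?thesis
    by (simp add: lookup_mult mult_when)
qed

section \<open>Restricting a polynomial to a set of monomials\<close>

definition filter_poly :: "('v monomial \<Rightarrow> bool) \<Rightarrow> ('v, 'a::field) mpoly \<Rightarrow> ('v, 'a) mpoly" where
  "filter_poly P p = Poly_Mapping.mapp (\<lambda>m c. c when P m) p"

lemma lookup_filter_poly:
  "Poly_Mapping.lookup (filter_poly P p) m = (Poly_Mapping.lookup p m when P m)"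
  by (auto simp: filter_poly_def lookup_mapp when_def in_keys_iff)

lemma keys_filter_poly: "Poly_Mapping.keys (filter_poly P p) = {m \<in> Poly_Mapping.keys p. P m}"
  by (auto simp: in_keys_iff lookup_filter_poly)

lemma filter_poly_in_polys [intro]: "p \<in> polys V \<Longrightarrow> filter_poly P p \<in> polys V"
  by (auto simp: polys_iff keys_filter_poly)

lemma filter_poly_0 [simp]: "filter_poly P 0 = 0"
  by (rule poly_mapping_eqI) (simp add: lookup_filter_poly)

lemma filter_poly_add: "filter_poly P (p + q) = filter_poly P p + filter_poly P q"
  by (rule poly_mapping_eqI) (simp add: lookup_filter_poly lookup_add when_add_distrib)

lemma filter_poly_sum: "filter_poly P (sum f A) = (\<Sum>i\<in>A. filter_poly P (f i))"
  by (induction A rule: infinite_finite_induct) (simp_all add: filter_poly_add)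

lemma filter_poly_id: "(\<And>m. m \<in> Poly_Mapping.keys p \<Longrightarrow> P m) \<Longrightarrow> filter_poly P p = p"
  by (rule poly_mapping_eqI) (auto simp: lookup_filter_poly when_def in_keys_iff)

lemma filter_poly_none: "(\<And>m. m \<in> Poly_Mapping.keys p \<Longrightarrow> \<not> P m) \<Longrightarrow> filter_poly P p = 0"
  by (rule poly_mapping_eqI) (auto simp: lookup_filter_poly when_def in_keys_iff)

lemma filter_poly_split: "filter_poly P p + filter_poly (\<lambda>m. \<not> P m) p = p"
  by (rule poly_mapping_eqI) (simp add: lookup_filter_poly lookup_add when_def)

lemma poly_as_sum_of_singles:
  "(\<Sum>m\<in>Poly_Mapping.keys p. Poly_Mapping.single m (Poly_Mapping.lookup p m)) = p"
  by (rule poly_mapping_eqI)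
    (auto simp: lookup_sum lookup_single when_def sum.delta' in_keys_iff)

lemma monomial_ge_single:
  assumes "x \<in> Poly_Mapping.keys (m :: 'v monomial)"
  obtains m' where "m = Poly_Mapping.single x 1 + m'"
proof
  show "m = Poly_Mapping.single x 1 + (m - Poly_Mapping.single x 1)"
    using assms by (intro poly_mapping_eqI) (auto simp: lookup_add lookup_minus lookup_single in_keys_iff when_def)
qed

lemma keys_monomial_add:
  "Poly_Mapping.keys (m + m' :: 'v monomial) = Poly_Mapping.keys m \<union> Poly_Mapping.keys m'"
  by (auto simp: in_keys_iff lookup_add)

section \<open>The Koszul complex\<close>

text \<open>
  An element of the Koszul complex is a family of polynomials indexed by sets of variables, the
  polynomial at \<open>T\<close> being the coefficient of the wedge product of the \<open>x \<in> T\<close>. The signs are those of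
  an iterated mapping cone, which avoids an order on the variables.
\<close>

primrec koszul :: "'v list \<Rightarrow> ('v set \<Rightarrow> ('v, 'a::field) mpoly) \<Rightarrow> 'v set \<Rightarrow> ('v, 'a) mpoly" where
  "koszul [] w T = 0"
| "koszul (x # xs) w T =
     (if x \<in> T then - koszul xs w T else var x * w (insert x T) + koszul xs w T)"

text \<open>The differential at \<open>T\<close> reads \<open>w\<close> only at \<open>T\<close>
  enlarged by one missing element of \<open>xs\<close>. This locality justifies all later
  replacements of a family by one that is altered elsewhere.\<close>

lemma koszul_cong:
  "(\<And>x. x \<in> set xs \<Longrightarrow> x \<notin> T \<Longrightarrow> w (insert x T) = w' (insert x T)) \<Longrightarrow> koszul xs w T = koszul xs w' T"
  by (induction xs) auto

lemma koszul_zero [simp]: "koszul xs (\<lambda>T. 0) T = 0"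
  by (induction xs) auto

lemma koszul_nonzeroE:
  assumes "koszul xs w T \<noteq> 0"
  obtains x where "x \<in> set xs" "x \<notin> T" "w (insert x T) \<noteq> 0"
proof -
  have "\<exists>x\<in>set xs. x \<notin> T \<and> w (insert x T) \<noteq> 0"
    using assms koszul_cong[of xs T w "\<lambda>T. 0"] koszul_zero[of xs T] by metis
  then show ?thesis using that by blast
qed

lemma koszul_add: "koszul xs (\<lambda>T. w T + w' T) T = koszul xs w T + koszul xs w' T"
  by (induction xs) (auto simp: algebra_simps)

lemma koszul_scale: "koszul xs (\<lambda>T. p * w T) T = p * koszul xs w T"
  by (induction xs) (auto simp: algebra_simps)

lemma koszul_uminus: "koszul xs (\<lambda>T. - w T) T = - koszul xs w T"
  by (induction xs) (auto simp: algebra_simps)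

lemma koszul_diff: "koszul xs (\<lambda>T. w T - w' T) T = koszul xs w T - koszul xs w' T"
  using koszul_add[of xs w "\<lambda>T. - w' T" T] by (simp add: koszul_uminus)

lemma koszul_sum: "koszul xs (\<lambda>T. \<Sum>i\<in>A. w i T) T = (\<Sum>i\<in>A. koszul xs (w i) T)"
  by (induction A rule: infinite_finite_induct) (auto simp: koszul_add)

lemma koszul_insert:
  "x \<notin> set xs \<Longrightarrow> koszul xs (\<lambda>S. w (insert x S)) T = koszul xs w (insert x T)"
  by (induction xs) (auto simp: insert_commute)

text \<open>The two mixed terms \<open>var x * koszul xs w (insert x T)\<close> cancel thanks to the
  minus sign in the branch \<open>x \<in> T\<close>.\<close>

lemma koszul_koszul:
  assumes "distinct xs"
  shows "koszul xs (koszul xs w) T = 0"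
  using assms
proof (induction xs arbitrary: T)
  case (Cons x xs)
  have x: "x \<notin> set xs" using Cons.prems by simp
  show ?case
  proof (cases "x \<in> T")
    case True
    have "koszul xs (koszul (x # xs) w) T = koszul xs (\<lambda>S. - koszul xs w S) T"
      by (rule koszul_cong) (use True in auto)
    also have "\<dots> = 0" using Cons by (simp add: koszul_uminus)
    finally show ?thesis using True by (subst koszul.simps) (simp del: koszul.simps)
  next
    case False
    have "koszul xs (koszul (x # xs) w) T =
        koszul xs (\<lambda>S. var x * w (insert x S) + koszul xs w S) T"
      by (rule koszul_cong) (use False x in auto)
    also have "\<dots> = var x * koszul xs w (insert x T)"
      using Cons x by (simp add: koszul_add koszul_scale koszul_insert)
    finally show ?thesis
      using False koszul.simps(2)[of x xs "koszul (x # xs) w" T] koszul.simps(2)[of x xs w "insert x T"]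
      by (simp del: koszul.simps)
  qed
qed simp

lemma koszul_in_polys:
  assumes "set xs \<subseteq> V" "\<And>S. w S \<in> polys V"
  shows "koszul xs w T \<in> polys V"
  using assms(1)
proof (induction xs)
  case (Cons x xs)
  then show ?case using assms(2) by auto
qed simp

lemma keys_koszul:
  assumes "m \<in> Poly_Mapping.keys (koszul xs w T)"
  shows "Poly_Mapping.keys m \<inter> set xs \<noteq> {}"
  using assms
proof (induction xs arbitrary: m)
  case (Cons x xs)
  show ?case
  proof (cases "x \<in> T")
    case True
    then show ?thesis using Cons by auto
  next
    case False
    then consider "m \<in> Poly_Mapping.keys (var x * w (insert x T))" | "m \<in> Poly_Mapping.keys (koszul xs w T)"
      using Cons.prems Poly_Mapping.keys_add[of "var x * w (insert x T)" "koszul xs w T"] by auto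
    then show ?thesis
    proof cases
      case 1
      then show ?thesis
        using keys_single_mult[of "Poly_Mapping.single x 1" 1 "w (insert x T)"]
        by (auto simp: var_def keys_monomial_add)
    next
      case 2
      then show ?thesis using Cons.IH by auto
    qed
  qed
qed simp

text \<open>The monomials that meet \<open>X\<close> are collected in \<open>g\<close>. Each of the
  others must contain \<open>x\<close>, so together they are a multiple of \<open>x\<close>. Thus
  (x, X) = (X) + (x), with explicit summands.\<close>

lemma split_off_variable:
  fixes p :: "('v, 'a::field) mpoly"
  assumes "p \<in> polys V" "\<And>m. m \<in> Poly_Mapping.keys p \<Longrightarrow> Poly_Mapping.keys m \<inter> insert x X \<noteq> {}"
  obtains g h where "p = g + var x * h" "g \<in> polys V" "h \<in> polys V"
    "\<And>m. m \<in> Poly_Mapping.keys g \<Longrightarrow> Poly_Mapping.keys m \<inter> X \<noteq> {}"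
proof
  let ?P = "\<lambda>m. Poly_Mapping.keys m \<inter> X \<noteq> {}"
  let ?N = "{m \<in> Poly_Mapping.keys p. \<not> ?P m}"
  let ?h = "\<Sum>m\<in>?N. Poly_Mapping.single (m - Poly_Mapping.single x 1) (Poly_Mapping.lookup p m)"
  have ge: "m = Poly_Mapping.single x 1 + (m - Poly_Mapping.single x 1)" if "m \<in> ?N" for m
  proof -
    have "x \<in> Poly_Mapping.keys m" using assms(2)[of m] that by auto
    then obtain m' where "m = Poly_Mapping.single x 1 + m'" by (rule monomial_ge_single)
    then show ?thesis by simp
  qed
  have "var x * ?h = (\<Sum>m\<in>?N. Poly_Mapping.single m (Poly_Mapping.lookup p m))"
    unfolding sum_distrib_left var_def
    by (intro sum.cong refl) (metis (lifting) ge mult_single mult_1)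
  also have "\<dots> = (\<Sum>m\<in>Poly_Mapping.keys (filter_poly (\<lambda>m. \<not> ?P m) p).
      Poly_Mapping.single m (Poly_Mapping.lookup (filter_poly (\<lambda>m. \<not> ?P m) p) m))"
    by (intro sum.cong) (auto simp: keys_filter_poly lookup_filter_poly)
  also have "\<dots> = filter_poly (\<lambda>m. \<not> ?P m) p" by (rule poly_as_sum_of_singles)
  finally show "p = filter_poly ?P p + var x * ?h" using filter_poly_split[of ?P p] by simp
  show "filter_poly ?P p \<in> polys V" using assms(1) by auto
  show "?h \<in> polys V"
  proof (intro polys_sum polys_single)
    fix m assume "m \<in> ?N"
    then have "Poly_Mapping.keys m \<subseteq> V" using assms(1) by (auto simp: polys_iff)
    then show "Poly_Mapping.keys (m - Poly_Mapping.single x 1) \<subseteq> V"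
      by (auto simp: in_keys_iff lookup_minus)
  qed
qed (auto simp: keys_filter_poly)

text \<open>Variables form a regular sequence, proved along the mapping cone. Elements of
  \<open>T\<close> outside \<open>xs\<close> are inert labels, so a family is a bundle of Koszul
  complexes, and the induction hypothesis handles the sets with and without \<open>x\<close> alike.
  The last premise concerns Koszul degree 0, where a boundary must lie in the ideal generated by
  \<open>xs\<close>.\<close>

lemma koszul_exact:
  assumes "distinct xs" "set xs \<subseteq> V" "\<And>T. w T \<in> polys V" "\<And>T. koszul xs w T = 0"
    and "\<And>T m. T \<inter> set xs = {} \<Longrightarrow> m \<in> Poly_Mapping.keys (w T) \<Longrightarrow> Poly_Mapping.keys m \<inter> set xs \<noteq> {}"
  shows "\<exists>y. (\<forall>T. y T \<in> polys V) \<and> (\<forall>T. koszul xs y T = w T)"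
  using assms
proof (induction xs arbitrary: w)
  case Nil
  have "w T = 0" for T using Nil.prems(5)[of T] by (auto simp flip: keys_eq_empty)
  then show ?case by (intro exI[of _ "\<lambda>T. 0"]) auto
next
  case (Cons x xs)
  have x: "x \<notin> set xs" "x \<in> V" "distinct xs" "set xs \<subseteq> V" using Cons.prems by auto
  have dw: "koszul xs w T = 0" if "x \<in> T" for T
    using Cons.prems(4)[of T] that by simp
  have dw': "var x * w (insert x T) + koszul xs w T = 0" if "x \<notin> T" for T
    using Cons.prems(4)[of T] that by simp
  \<comment> \<open>The components with \<open>x\<close> in the index set form a cycle for the
    shorter list. Its primitive \<open>c\<close> will supply these components of the final
    primitive, up to sign.\<close>
  define w1 where "w1 T = (if x \<in> T then w T else 0)" for T
  have "\<exists>c. (\<forall>T. c T \<in> polys V) \<and> (\<forall>T. koszul xs c T = w1 T)"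
  proof (rule Cons.IH)
    show "w1 T \<in> polys V" for T using Cons.prems(3) by (simp add: w1_def)
    show "koszul xs w1 T = 0" for T
    proof (cases "x \<in> T")
      case True
      then have "koszul xs w1 T = koszul xs w T" by (intro koszul_cong) (simp add: w1_def)
      then show ?thesis using dw True by simp
    next
      case False
      have "koszul xs w1 T = koszul xs (\<lambda>T. 0) T"
        by (intro koszul_cong) (use False x in \<open>auto simp: w1_def\<close>)
      then show ?thesis by simp
    qed
    fix T m assume T: "T \<inter> set xs = {}" "m \<in> Poly_Mapping.keys (w1 T)"
    then have xT: "x \<in> T" "m \<in> Poly_Mapping.keys (w T)" by (auto simp: w1_def split: if_splits)
    \<comment> \<open>In degree 0 the cycle equation puts \<open>x * w T\<close> into the ideal
      generated by \<open>xs\<close>. Since \<open>x\<close> is not in \<open>xs\<close>, cancelling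
      it from a monomial keeps the monomial in that ideal.\<close>
    have "var x * w T = - koszul xs w (T - {x})"
      using dw'[of "T - {x}"] xT by (simp add: insert_absorb eq_neg_iff_add_eq_0)
    moreover have "Poly_Mapping.lookup (var x * w T) (Poly_Mapping.single x 1 + m) \<noteq> 0"
      unfolding var_def lookup_single_mult using xT by (simp add: in_keys_iff)
    ultimately have "Poly_Mapping.single x 1 + m \<in> Poly_Mapping.keys (koszul xs w (T - {x}))"
      by (simp add: in_keys_iff)
    from keys_koszul[OF this] show "Poly_Mapping.keys m \<inter> set xs \<noteq> {}"
      using x(1) by (auto simp: keys_monomial_add)
  qed (use x in auto)
  then obtain c where c: "\<And>T. c T \<in> polys V" "\<And>T. koszul xs c T = w1 T" by blast
  have "\<exists>g h. w T = g + var x * h \<and> g \<in> polys V \<and> h \<in> polys V \<and>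
      (\<forall>m\<in>Poly_Mapping.keys g. Poly_Mapping.keys m \<inter> set xs \<noteq> {})"
    if "T \<inter> set (x # xs) = {}" for T
    using split_off_variable[of "w T" V x "set xs"] Cons.prems(3)[of T] Cons.prems(5)[OF that]
    by (metis list.simps(15))
  then obtain g h where gh: "\<And>T. T \<inter> set (x # xs) = {} \<Longrightarrow> w T = g T + var x * h T \<and>
      g T \<in> polys V \<and> h T \<in> polys V \<and> (\<forall>m\<in>Poly_Mapping.keys (g T). Poly_Mapping.keys m \<inter> set xs \<noteq> {})"
    by metis
  txt \<open>The values of \<open>c\<close> at sets that do not meet \<open>xs\<close> do not enter \<open>koszul xs c\<close>, so that they may be
    chosen freely.\<close>
  define c' where "c' T = (if x \<in> T \<and> T \<inter> set xs = {} then - h (T - {x}) else c T)" for T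
  have c'_polys: "c' T \<in> polys V" for T
  proof (cases "x \<in> T \<and> T \<inter> set xs = {}")
    case True
    then have "(T - {x}) \<inter> set (x # xs) = {}" by auto
    then show ?thesis using gh True by (auto simp: c'_def)
  qed (use c in \<open>auto simp: c'_def\<close>)
  have c'_d: "koszul xs c' T = w1 T" for T
  proof -
    have "koszul xs c' T = koszul xs c T" by (intro koszul_cong) (auto simp: c'_def)
    then show ?thesis using c by simp
  qed
  \<comment> \<open>This is what the \<open>x\<close>-components \<open>- c'\<close> of the
    primitive leave of \<open>w\<close> over sets without \<open>x\<close>. It is a cycle for
    \<open>xs\<close>, and in degree 0 the choice of \<open>c'\<close> cancels the term
    \<open>x * h T\<close>, leaving \<open>g T\<close> in the ideal generated by
    \<open>xs\<close>.\<close>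
  define a where "a T = (if x \<in> T then 0 else w T + var x * c' (insert x T))" for T
  have "\<exists>y. (\<forall>T. y T \<in> polys V) \<and> (\<forall>T. koszul xs y T = a T)"
  proof (rule Cons.IH)
    show "a T \<in> polys V" for T using Cons.prems(3) c'_polys x by (auto simp: a_def)
    show "koszul xs a T = 0" for T
    proof (cases "x \<in> T")
      case True
      then have "koszul xs a T = koszul xs (\<lambda>T. 0) T" by (intro koszul_cong) (simp add: a_def)
      then show ?thesis by simp
    next
      case False
      have "koszul xs a T = koszul xs (\<lambda>T. w T + var x * c' (insert x T)) T"
        by (intro koszul_cong) (use False x in \<open>auto simp: a_def\<close>)
      also have "\<dots> = koszul xs w T + var x * w1 (insert x T)"
        using x by (simp add: koszul_add koszul_scale koszul_insert c'_d)
      finally show ?thesis using dw'[OF False] by (simp add: w1_def add.commute)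
    qed
    fix T m assume T: "T \<inter> set xs = {}" "m \<in> Poly_Mapping.keys (a T)"
    then have "x \<notin> T" by (auto simp: a_def)
    then have "T \<inter> set (x # xs) = {}" "insert x T - {x} = T" using T by auto
    moreover from this have "c' (insert x T) = - h T" using x by (auto simp: c'_def)
    ultimately show "Poly_Mapping.keys m \<inter> set xs \<noteq> {}"
      using T gh[of T] \<open>x \<notin> T\<close> by (auto simp: a_def)
  qed (use x in auto)
  then obtain y where y: "\<And>T. y T \<in> polys V" "\<And>T. koszul xs y T = a T" by blast
  define z where "z T = (if x \<in> T then - c' T else y T)" for T
  show ?case
  proof (intro exI[of _ z] conjI allI)
    show "z T \<in> polys V" for T using y c'_polys by (auto simp: z_def)
    show "koszul (x # xs) z T = w T" for T
    proof (cases "x \<in> T")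
      case True
      have "koszul xs z T = koszul xs (\<lambda>S. - c' S) T"
        by (intro koszul_cong) (use True in \<open>auto simp: z_def\<close>)
      then show ?thesis using True by (simp add: koszul_uminus c'_d w1_def)
    next
      case False
      have "koszul xs z T = koszul xs y T"
        by (intro koszul_cong) (use False x in \<open>auto simp: z_def\<close>)
      then show ?thesis using False y by (simp add: a_def z_def)
    qed
  qed
qed

text \<open>A linear monomial \<open>y\<close> in a Koszul boundary can only be \<open>y\<close>
  times a constant. Linear coefficients of a boundary therefore reveal constant coefficients of the
  chain. The sign depends on the list, so only \<open>\<epsilon> \<noteq> 0\<close> is
  recorded.\<close>

lemma lookup_koszul_single:
  assumes "distinct xs" "y \<in> set xs" "y \<notin> T"
  shows "\<exists>\<epsilon>. \<epsilon> \<noteq> 0 \<and> Poly_Mapping.lookup (koszul xs w T) (Poly_Mapping.single y 1) =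
    \<epsilon> * Poly_Mapping.lookup (w (insert y T)) 0"
  using assms(1,2)
proof (induction xs)
  case (Cons x xs)
  show ?case
  proof (cases "x = y")
    case True
    then have "Poly_Mapping.lookup (koszul xs w T) (Poly_Mapping.single y 1) = 0"
      using keys_koszul[of "Poly_Mapping.single y 1" xs w T] Cons.prems by (auto simp: in_keys_iff)
    then show ?thesis
      using True assms(3) lookup_single_mult[of "Poly_Mapping.single y 1" 1 "w (insert y T)" 0]
      by (intro exI[of _ 1]) (simp add: lookup_add var_def)
  next
    case False
    then obtain \<epsilon> where "\<epsilon> \<noteq> 0" "Poly_Mapping.lookup (koszul xs w T) (Poly_Mapping.single y 1) =
      \<epsilon> * Poly_Mapping.lookup (w (insert y T)) 0" using Cons by auto
    moreover have "Poly_Mapping.lookup (var x * p) (Poly_Mapping.single y 1) = 0" for p :: "('a, 'b) mpoly"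
    proof (rule ccontr)
      assume "Poly_Mapping.lookup (var x * p) (Poly_Mapping.single y 1) \<noteq> 0"
      then have "Poly_Mapping.single y 1 \<in> Poly_Mapping.keys (var x * p)" by (simp add: in_keys_iff)
      then obtain m where "Poly_Mapping.single y (1::nat) = Poly_Mapping.single x 1 + m"
        using keys_single_mult[of "Poly_Mapping.single x 1" 1 p] by (auto simp: var_def)
      then have "Poly_Mapping.keys (Poly_Mapping.single y (1::nat)) = insert x (Poly_Mapping.keys m)"
        by (simp add: keys_monomial_add)
      then show False using False by auto
    qed
    ultimately show ?thesis
      by (cases "x \<in> T") (auto simp: lookup_add intro: exI[of _ \<epsilon>] exI[of _ "- \<epsilon>"])
  qed
qed simp

section \<open>Comparing an exact complex with the Koszul complex\<close>

definition koszul_chains :: "'v set \<Rightarrow> nat \<Rightarrow> ('v set \<Rightarrow> ('v, 'a::field) mpoly) set" where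
  "koszul_chains V q = {w. \<forall>T. w T \<in> polys V \<and> (w T \<noteq> 0 \<longrightarrow> T \<subseteq> V \<and> card T = q)}"

text \<open>The primitive from \<open>koszul_exact\<close> may have components in other degrees and
  is cut down to subsets of size \<open>q + 1\<close>. Only degree 0 carries a condition, since the
  boundaries there are the polynomials without constant term.\<close>

lemma koszul_chains_exact:
  fixes w :: "'v set \<Rightarrow> ('v, 'a::field) mpoly"
  assumes "distinct xs" "w \<in> koszul_chains (set xs) q" "\<And>T. koszul xs w T = 0"
    and "q = 0 \<Longrightarrow> Poly_Mapping.lookup (w {}) 0 = 0"
  shows "\<exists>y\<in>koszul_chains (set xs) (Suc q). \<forall>T. koszul xs y T = w T"
proof -
  let ?V = "set xs"
  have "\<exists>y. (\<forall>T. y T \<in> polys ?V) \<and> (\<forall>T. koszul xs y T = w T)"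
  proof (rule koszul_exact)
    show "w T \<in> polys ?V" for T using assms(2) by (auto simp: koszul_chains_def)
    fix T m assume T: "T \<inter> ?V = {}" "m \<in> Poly_Mapping.keys (w T)"
    then have "w T \<noteq> 0" by auto
    then have "T \<subseteq> ?V" "card T = q" using assms(2) by (auto simp: koszul_chains_def)
    with T have "T = {}" by auto
    then have "q = 0" using \<open>card T = q\<close> by simp
    with T \<open>T = {}\<close> assms(4) have "m \<noteq> 0" by (auto simp: in_keys_iff)
    moreover have "Poly_Mapping.keys m \<subseteq> ?V" using T assms(2) by (auto simp: koszul_chains_def polys_iff)
    ultimately show "Poly_Mapping.keys m \<inter> ?V \<noteq> {}" by (auto simp flip: keys_eq_empty)
  qed (use assms in auto)
  then obtain y where y: "\<And>T. y T \<in> polys ?V" "\<And>T. koszul xs y T = w T" by blast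
  define z where "z T = (if T \<subseteq> ?V \<and> card T = Suc q then y T else 0)" for T
  have z: "z \<in> koszul_chains ?V (Suc q)" using y by (auto simp: koszul_chains_def z_def)
  moreover have "koszul xs z T = w T" for T
  proof (cases "T \<subseteq> ?V \<and> card T = q")
    case True
    then have "koszul xs z T = koszul xs y T"
      by (intro koszul_cong) (auto simp: z_def finite_subset)
    then show ?thesis using y by simp
  next
    case False
    have "koszul xs z T = 0"
    proof (rule ccontr)
      assume "koszul xs z T \<noteq> 0"
      then obtain x where "x \<notin> T" "z (insert x T) \<noteq> 0" by (rule koszul_nonzeroE)
      then have "T \<subseteq> ?V" "card (insert x T) = Suc q" by (auto simp: z_def split: if_splits)
      then show False using False \<open>x \<notin> T\<close> finite_subset[of T ?V] by simp
    qed
    then show ?thesis using False assms(2) by (auto simp: koszul_chains_def)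
  qed
  ultimately show ?thesis by blast
qed

lemma koszul_koszul_chains:
  assumes "w \<in> koszul_chains (set xs) (Suc q)"
  shows "koszul xs w \<in> koszul_chains (set xs) q"
proof -
  have "T \<subseteq> set xs \<and> card T = q" if "koszul xs w T \<noteq> 0" for T
  proof -
    from that obtain x where "x \<notin> T" "w (insert x T) \<noteq> 0" by (rule koszul_nonzeroE)
    then have "insert x T \<subseteq> set xs" "card (insert x T) = Suc q" using assms by (auto simp: koszul_chains_def)
    then show ?thesis using \<open>x \<notin> T\<close> finite_subset[of T "set xs"] by simp
  qed
  then show ?thesis using assms koszul_in_polys[of xs "set xs" w] by (auto simp: koszul_chains_def)
qed

lemma koszul_chains_0_cycle:
  assumes "w \<in> koszul_chains (set xs) 0"
  shows "koszul xs w T = 0"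
proof (rule ccontr)
  assume "koszul xs w T \<noteq> 0"
  then obtain x where "w (insert x T) \<noteq> 0" by (rule koszul_nonzeroE)
  then have "insert x T \<subseteq> set xs" "card (insert x T) = 0" using assms by (auto simp: koszul_chains_def)
  then show False using finite_subset[of "insert x T" "set xs"] by simp
qed

lemma koszul_chains_add: "w \<in> koszul_chains V q \<Longrightarrow> w' \<in> koszul_chains V q \<Longrightarrow> (\<lambda>T. w T + w' T) \<in> koszul_chains V q"
  unfolding koszul_chains_def by (clarsimp simp: polys_add) (metis add.right_neutral)

lemma koszul_chains_scale: "p \<in> polys V \<Longrightarrow> w \<in> koszul_chains V q \<Longrightarrow> (\<lambda>T. p * w T) \<in> koszul_chains V q"
  unfolding koszul_chains_def by (clarsimp simp: polys_mult) (metis mult_zero_right)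

lemma koszul_chains_zero: "(\<lambda>T. 0) \<in> koszul_chains V q"
  by (auto simp: koszul_chains_def)

lemma koszul_chains_sum:
  "(\<And>i. i \<in> A \<Longrightarrow> w i \<in> koszul_chains V q) \<Longrightarrow> (\<lambda>T. \<Sum>i\<in>A. w i T) \<in> koszul_chains V q"
  by (induction A rule: infinite_finite_induct) (auto intro: koszul_chains_add koszul_chains_zero)

lemma koszul_chains_diff:
  "w \<in> koszul_chains V q \<Longrightarrow> w' \<in> koszul_chains V q \<Longrightarrow> (\<lambda>T. w T - w' T) \<in> koszul_chains V q"
  using koszul_chains_add[OF _ koszul_chains_scale[of "-1"], of w V q w'] by (simp add: polys_uminus)

lemma koszul_chains_eq_0:
  assumes "finite V" "card V < q" "w \<in> koszul_chains V q"
  shows "w T = 0"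
  using assms card_mono[of V T] by (force simp: koszul_chains_def)

text \<open>
  \<open>a i\<close> is the matrix of the map from the term \<open>i + 1\<close> to the term \<open>i\<close> of a complex of free modules over
  the polynomial ring in the variables \<open>xs\<close>, the term \<open>i\<close> having rank \<open>rk i\<close>.
\<close>

locale minimal_exact_complex =
  fixes xs :: "'v list" and rk :: "nat \<Rightarrow> nat" and a :: "nat \<Rightarrow> nat \<Rightarrow> nat \<Rightarrow> ('v, 'a::field) mpoly"
  assumes distinct_xs: "distinct xs"
    and entries_in_polys: "r < rk i \<Longrightarrow> c < rk (Suc i) \<Longrightarrow> a i r c \<in> polys (set xs)"
    and minimal: "r < rk i \<Longrightarrow> c < rk (Suc i) \<Longrightarrow> Poly_Mapping.lookup (a i r c) 0 = 0"
    and exact: "(\<And>c. c < rk (Suc i) \<Longrightarrow> u c \<in> polys (set xs)) \<Longrightarrow>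
      (\<forall>r<rk i. (\<Sum>c<rk (Suc i). a i r c * u c) = 0) \<longleftrightarrow>
      (\<exists>w. (\<forall>d<rk (Suc (Suc i)). w d \<in> polys (set xs)) \<and>
         (\<forall>c<rk (Suc i). u c = (\<Sum>d<rk (Suc (Suc i)). a (Suc i) c d * w d)))"
begin

text \<open>The term in position \<open>(p, q)\<close> of the double complex, the tensor product with the Koszul complex.\<close>

definition chains :: "nat \<Rightarrow> nat \<Rightarrow> (nat \<Rightarrow> 'v set \<Rightarrow> ('v, 'a) mpoly) set" where
  "chains p q = {z. \<forall>c<rk p. z c \<in> koszul_chains (set xs) q}"

definition bd :: "nat \<Rightarrow> (nat \<Rightarrow> 'v set \<Rightarrow> ('v, 'a) mpoly) \<Rightarrow> nat \<Rightarrow> 'v set \<Rightarrow> ('v, 'a) mpoly" where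
  "bd p z r T = (\<Sum>c<rk (Suc p). a p r c * z c T)"

lemma bd_chains: "z \<in> chains (Suc p) q \<Longrightarrow> bd p z \<in> chains p q"
  unfolding chains_def bd_def
  by (auto intro!: koszul_chains_sum koszul_chains_scale entries_in_polys)

lemma koszul_chains_family:
  "z \<in> chains p (Suc q) \<Longrightarrow> (\<lambda>c. koszul xs (z c)) \<in> chains p q"
  unfolding chains_def by (auto intro: koszul_koszul_chains)

lemma diff_chains: "z \<in> chains p q \<Longrightarrow> z' \<in> chains p q \<Longrightarrow> (\<lambda>c T. z c T - z' c T) \<in> chains p q"
  unfolding chains_def by (auto intro: koszul_chains_diff)

lemma koszul_bd: "koszul xs (bd p z r) T = bd p (\<lambda>c. koszul xs (z c)) r T"
  unfolding bd_def by (simp add: koszul_sum koszul_scale)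

lemma bd_diff: "bd p (\<lambda>c T. z c T - z' c T) r T = bd p z r T - bd p z' r T"
  unfolding bd_def by (simp add: algebra_simps sum_subtractf)

lemma bd_cong: "(\<And>c. c < rk (Suc p) \<Longrightarrow> z c T = z' c T) \<Longrightarrow> bd p z r T = bd p z' r T"
  unfolding bd_def by (auto intro: sum.cong)

lemma bd_bd:
  assumes "z \<in> chains (Suc (Suc p)) q" "r < rk p"
  shows "bd p (bd (Suc p) z) r T = 0"
proof -
  have "bd (Suc p) z c T \<in> polys (set xs)" if "c < rk (Suc p)" for c
    using bd_chains[OF assms(1)] that by (auto simp: chains_def koszul_chains_def)
  moreover have "\<forall>d<rk (Suc (Suc p)). z d T \<in> polys (set xs)"
    using assms(1) by (auto simp: chains_def koszul_chains_def)
  ultimately have "\<forall>r<rk p. (\<Sum>c<rk (Suc p). a p r c * bd (Suc p) z c T) = 0"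
    by (subst exact) (auto simp: bd_def)
  then show ?thesis using assms(2) by (simp add: bd_def)
qed

lemma bd_exact:
  assumes "z \<in> chains (Suc p) q" "\<And>r T. r < rk p \<Longrightarrow> bd p z r T = 0"
  shows "\<exists>y\<in>chains (Suc (Suc p)) q. \<forall>c<rk (Suc p). \<forall>T. z c T = bd (Suc p) y c T"
proof -
  have "\<exists>w. (\<forall>d<rk (Suc (Suc p)). w d \<in> polys (set xs)) \<and>
      (\<forall>c<rk (Suc p). z c T = (\<Sum>d<rk (Suc (Suc p)). a (Suc p) c d * w d))" for T
    using assms exact[of p "\<lambda>c. z c T"] by (auto simp: chains_def koszul_chains_def bd_def)
  then obtain w where w: "\<And>T d. d < rk (Suc (Suc p)) \<Longrightarrow> w T d \<in> polys (set xs)"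
    "\<And>T c. c < rk (Suc p) \<Longrightarrow> z c T = (\<Sum>d<rk (Suc (Suc p)). a (Suc p) c d * w T d)" by metis
  define y where "y d T = (if T \<subseteq> set xs \<and> card T = q then w T d else 0)" for d T
  have "y \<in> chains (Suc (Suc p)) q" using w by (auto simp: chains_def koszul_chains_def y_def)
  moreover have "z c T = bd (Suc p) y c T" if "c < rk (Suc p)" for c T
  proof (cases "T \<subseteq> set xs \<and> card T = q")
    case True
    then show ?thesis using w that by (simp add: bd_def y_def)
  next
    case False
    have "z c T = 0" using False assms(1) that unfolding chains_def koszul_chains_def by blast
    moreover have "y d T = 0" for d using False by (auto simp: y_def)
    ultimately show ?thesis by (simp add: bd_def)
  qed
  ultimately show ?thesis by blast
qed

lemma koszul_exact_family:
  assumes "z \<in> chains p q" "\<And>c T. c < rk p \<Longrightarrow> koszul xs (z c) T = 0"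
    and "\<And>c. q = 0 \<Longrightarrow> c < rk p \<Longrightarrow> Poly_Mapping.lookup (z c {}) 0 = 0"
  shows "\<exists>y\<in>chains p (Suc q). \<forall>c<rk p. \<forall>T. z c T = koszul xs (y c) T"
proof -
  have "\<exists>y\<in>koszul_chains (set xs) (Suc q). \<forall>T. koszul xs y T = z c T" if "c < rk p" for c
    using that assms by (intro koszul_chains_exact[OF distinct_xs]) (auto simp: chains_def)
  then obtain y where "\<And>c. c < rk p \<Longrightarrow> y c \<in> koszul_chains (set xs) (Suc q)"
    "\<And>c T. c < rk p \<Longrightarrow> koszul xs (y c) T = z c T" by metis
  then show ?thesis by (intro bexI[of _ y]) (auto simp: chains_def)
qed

section \<open>Upper bound: no terms beyond the number of variables\<close>

lemma lookup_bd_0: "r < rk p \<Longrightarrow> Poly_Mapping.lookup (bd p z r T) 0 = 0"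
  unfolding bd_def by (simp add: lookup_sum lookup_mult_0 minimal)

text \<open>The induction moves along a diagonal of constant total degree: \<open>bd p z\<close> is
  a Koszul cycle, hence the Koszul boundary of some \<open>z'\<close> one step lower in
  \<open>p\<close> and one step higher in \<open>q\<close>. By minimality it has no constant terms,
  as required when \<open>q = 0\<close>. At the end of the diagonal the Koszul degree of
  \<open>z'\<close> exceeds the number of variables, so \<open>z'\<close> vanishes and exactness
  applies to \<open>z\<close> directly.\<close>

lemma decompose_high_chains:
  assumes "z \<in> chains (Suc p) q" "length xs < Suc p + q"
    and "\<And>r T. r < rk p \<Longrightarrow> koszul xs (bd p z r) T = 0"
  shows "\<exists>y\<in>chains (Suc p) (Suc q). \<exists>y'\<in>chains (Suc (Suc p)) q.
    \<forall>c<rk (Suc p). \<forall>T. z c T = koszul xs (y c) T + bd (Suc p) y' c T"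
  using assms
proof (induction p arbitrary: q z)
  case 0
  obtain z' where z': "z' \<in> chains 0 (Suc q)" "\<forall>c<rk 0. \<forall>T. bd 0 z c T = koszul xs (z' c) T"
    using koszul_exact_family[OF bd_chains[OF 0(1)] 0(3)] lookup_bd_0[of _ 0 z "{}"] by auto
  have "z' c T = 0" if "c < rk 0" for c T
    using koszul_chains_eq_0[of "set xs" "Suc q" "z' c" T] 0(2) z'(1) that distinct_xs
    by (auto simp: chains_def distinct_card)
  then have "koszul xs (z' c) T = 0" if "c < rk 0" for c T
    using that koszul_cong[of xs T "z' c" "\<lambda>T. 0"] by simp
  then have "\<And>r T. r < rk 0 \<Longrightarrow> bd 0 z r T = 0" using z' by simp
  from bd_exact[OF 0(1) this] obtain y where "y \<in> chains (Suc (Suc 0)) q"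
    "\<forall>c<rk (Suc 0). \<forall>T. z c T = bd (Suc 0) y c T" by blast
  then show ?case
    by (intro bexI[of _ "\<lambda>c T. 0"] bexI[of _ y]) (auto simp: chains_def koszul_chains_zero)
next
  case (Suc p)
  obtain z' where z': "z' \<in> chains (Suc p) (Suc q)" "\<forall>c<rk (Suc p). \<forall>T. bd (Suc p) z c T = koszul xs (z' c) T"
    using koszul_exact_family[OF bd_chains[OF Suc.prems(1)] Suc.prems(3)] lookup_bd_0[of _ "Suc p" z "{}"] by auto
  have "koszul xs (bd p z' r) T = 0" if "r < rk p" for r T
  proof -
    have "koszul xs (bd p z' r) T = bd p (bd (Suc p) z) r T"
      unfolding koszul_bd by (rule bd_cong) (use z' in auto)
    then show ?thesis using bd_bd[OF Suc.prems(1) that] by simp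
  qed
  with Suc.IH[OF z'(1)] Suc.prems(2) obtain y y' where
    y: "y \<in> chains (Suc p) (Suc (Suc q))" "y' \<in> chains (Suc (Suc p)) (Suc q)"
    "\<forall>c<rk (Suc p). \<forall>T. z' c T = koszul xs (y c) T + bd (Suc p) y' c T"
    by auto
  \<comment> \<open>Applying \<open>bd\<close> to this difference gives the Koszul differential of
    \<open>z' - bd y'\<close>, which is the Koszul differential applied twice to \<open>y\<close>,
    hence 0. Exactness of the complex then yields \<open>v\<close>.\<close>
  let ?u = "\<lambda>c T. z c T - koszul xs (y' c) T"
  have "bd (Suc p) ?u c T = 0" if "c < rk (Suc p)" for c T
  proof -
    have "bd (Suc p) ?u c T = koszul xs (z' c) T - koszul xs (bd (Suc p) y' c) T"
      using z' that by (simp add: bd_diff koszul_bd)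
    also have "\<dots> = koszul xs (\<lambda>T. z' c T - bd (Suc p) y' c T) T" by (simp add: koszul_diff)
    also have "\<dots> = koszul xs (koszul xs (y c)) T" by (rule koszul_cong) (use y that in auto)
    finally show ?thesis using koszul_koszul[OF distinct_xs] by metis
  qed
  moreover have "?u \<in> chains (Suc (Suc p)) q"
    by (intro diff_chains Suc.prems koszul_chains_family y)
  ultimately obtain v where "v \<in> chains (Suc (Suc (Suc p))) q"
    "\<forall>c<rk (Suc (Suc p)). \<forall>T. ?u c T = bd (Suc (Suc p)) v c T"
    using bd_exact[of ?u "Suc p" q] by auto
  then show ?case using y by (intro bexI[of _ y'] bexI[of _ v]) (auto simp: algebra_simps)
qed

text \<open>Otherwise a basis vector, placed in Koszul degree 0, would be a Koszul boundary plus an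
  image under \<open>bd\<close>, and neither of these has constant terms.\<close>

lemma rank_eq_0:
  assumes "length xs < p"
  shows "rk p = 0"
proof (rule ccontr)
  assume "rk p \<noteq> 0"
  obtain p' where p: "p = Suc p'" using assms by (cases p) auto
  define z where "z c T = (if c = 0 \<and> T = {} then 1 else (0 :: ('v, 'a) mpoly))" for c :: nat and T :: "'v set"
  have z: "z \<in> chains p 0" by (auto simp: chains_def koszul_chains_def z_def)
  then have "koszul xs (bd p' z r) T = 0" if "r < rk p'" for r T
    using bd_chains[of z p' 0] that p by (intro koszul_chains_0_cycle) (auto simp: chains_def)
  then obtain y y' where "y \<in> chains p (Suc 0)"
    "\<forall>c<rk p. \<forall>T. z c T = koszul xs (y c) T + bd p y' c T"
    using decompose_high_chains[of z p' 0] z p assms by auto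
  then have "Poly_Mapping.lookup (z 0 {}) 0 = Poly_Mapping.lookup (koszul xs (y 0) {}) 0"
    using \<open>rk p \<noteq> 0\<close> lookup_bd_0[of 0 p y' "{}"] by (simp add: lookup_add)
  also have "\<dots> = 0" using keys_koszul[of 0 xs "y 0" "{}"] by (auto simp: in_keys_iff)
  finally show False by (simp add: z_def)
qed

text \<open>A staircase from position \<open>(p, q)\<close> to \<open>(p + q, 0)\<close>: the Koszul
  differential of each chain is \<open>bd\<close> of the next. The constant terms of
  \<open>u c {}\<close> at its end represent the class in Tor.\<close>

primrec zigzag :: "nat \<Rightarrow> nat \<Rightarrow> (nat \<Rightarrow> 'v set \<Rightarrow> ('v, 'a) mpoly) \<Rightarrow> (nat \<Rightarrow> 'v set \<Rightarrow> ('v, 'a) mpoly) \<Rightarrow> bool" where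
  "zigzag 0 p z u \<longleftrightarrow> z \<in> chains p 0 \<and> (\<forall>c<rk p. u c {} = z c {})"
| "zigzag (Suc q) p z u \<longleftrightarrow> z \<in> chains p (Suc q) \<and>
     (\<exists>z'. (\<forall>c<rk p. \<forall>T. koszul xs (z c) T = bd p z' c T) \<and> zigzag q (Suc p) z' u)"

text \<open>Exactness is available from position 1 on, hence \<open>Suc p\<close>. Only the first
  stair has to be assumed to lie in the kernel of \<open>bd\<close>; for the later ones this follows
  from the square of the Koszul differential being 0. With \<open>q = 0\<close> there is no stair at
  all.\<close>

lemma zigzag_exists:
  assumes "z \<in> chains (Suc p) q" "\<And>r T. q \<noteq> 0 \<Longrightarrow> r < rk p \<Longrightarrow> bd p (\<lambda>c. koszul xs (z c)) r T = 0"
  shows "\<exists>u. zigzag q (Suc p) z u"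
  using assms
proof (induction q arbitrary: p z)
  case (Suc q)
  obtain z' where z': "z' \<in> chains (Suc (Suc p)) q"
    "\<forall>c<rk (Suc p). \<forall>T. koszul xs (z c) T = bd (Suc p) z' c T"
    using bd_exact[OF koszul_chains_family[OF Suc.prems(1)] Suc.prems(2)] by auto
  have "bd (Suc p) (\<lambda>c. koszul xs (z' c)) r T = 0" if "r < rk (Suc p)" for r T
  proof -
    have "koszul xs (bd (Suc p) z' r) T = koszul xs (koszul xs (z r)) T"
      by (rule koszul_cong) (use z' that in auto)
    then show ?thesis using koszul_koszul[OF distinct_xs] by (metis koszul_bd)
  qed
  with Suc.IH[OF z'(1)] obtain u where "zigzag q (Suc (Suc p)) z' u" by auto
  then show ?case using Suc.prems(1) z'(2) by auto
qed auto

lemma zigzag_sum: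
  assumes "\<And>s. s \<in> A \<Longrightarrow> zigzag q p (z s) (u s)" "\<And>s. s \<in> A \<Longrightarrow> k s \<in> polys (set xs)"
  shows "zigzag q p (\<lambda>c T. \<Sum>s\<in>A. k s * z s c T) (\<lambda>c T. \<Sum>s\<in>A. k s * u s c T)"
  using assms(1)
proof (induction q arbitrary: p z)
  case 0
  then show ?case using assms(2)
    by (auto simp: chains_def intro!: koszul_chains_sum koszul_chains_scale sum.cong)
next
  case (Suc q)
  then obtain z' where z': "\<And>s c T. s \<in> A \<Longrightarrow> c < rk p \<Longrightarrow> koszul xs (z s c) T = bd p (z' s) c T"
    "\<And>s. s \<in> A \<Longrightarrow> zigzag q (Suc p) (z' s) (u s)" by simp metis
  have "koszul xs (\<lambda>T. \<Sum>s\<in>A. k s * z s c T) T = bd p (\<lambda>c T. \<Sum>s\<in>A. k s * z' s c T) c T"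
    if "c < rk p" for c T
  proof -
    have "koszul xs (\<lambda>T. \<Sum>s\<in>A. k s * z s c T) T = (\<Sum>s\<in>A. k s * bd p (z' s) c T)"
      using z' that by (simp add: koszul_sum koszul_scale)
    also have "\<dots> = (\<Sum>s\<in>A. \<Sum>c'<rk (Suc p). a p c c' * (k s * z' s c' T))"
      by (simp add: bd_def sum_distrib_left mult_ac)
    also have "\<dots> = bd p (\<lambda>c T. \<Sum>s\<in>A. k s * z' s c T) c T"
      unfolding bd_def sum_distrib_left by (rule sum.swap)
    finally show ?thesis .
  qed
  moreover have "(\<lambda>c T. \<Sum>s\<in>A. k s * z s c T) \<in> chains p (Suc q)"
    using Suc.prems assms(2) by (auto simp: chains_def intro!: koszul_chains_sum koszul_chains_scale)
  ultimately show ?case using Suc.IH[OF z'(2)] by auto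
qed

text \<open>This is the injectivity: the staircase is climbed back. At its end a chain without
  constant terms is a Koszul boundary. One stair up, if \<open>z' = koszul y + bd y'\<close>, then
  \<open>z - bd p y\<close> is a Koszul cycle of positive degree, hence a boundary.\<close>

lemma zigzag_boundary:
  assumes "zigzag q p z u" "\<And>c. c < rk (p + q) \<Longrightarrow> Poly_Mapping.lookup (u c {}) 0 = 0"
  shows "\<exists>y\<in>chains p (Suc q). \<exists>y'\<in>chains (Suc p) q.
    \<forall>c<rk p. \<forall>T. z c T = koszul xs (y c) T + bd p y' c T"
  using assms
proof (induction q arbitrary: p z)
  case 0
  then have "z \<in> chains p 0" by simp
  then have "koszul xs (z c) T = 0" if "c < rk p" for c T
    using that by (intro koszul_chains_0_cycle) (auto simp: chains_def)
  with koszul_exact_family[of z p 0] 0 obtain y where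
    "y \<in> chains p (Suc 0)" "\<forall>c<rk p. \<forall>T. z c T = koszul xs (y c) T" by auto
  then show ?case
    by (intro bexI[of _ y] bexI[of _ "\<lambda>c T. 0"]) (auto simp: bd_def chains_def koszul_chains_zero)
next
  case (Suc q)
  then obtain z' where z': "\<forall>c<rk p. \<forall>T. koszul xs (z c) T = bd p z' c T" "zigzag q (Suc p) z' u"
    and z: "z \<in> chains p (Suc q)" by auto
  from Suc.IH[OF z'(2)] Suc.prems(2) obtain y y' where y: "y \<in> chains (Suc p) (Suc q)"
    "y' \<in> chains (Suc (Suc p)) q" "\<forall>c<rk (Suc p). \<forall>T. z' c T = koszul xs (y c) T + bd (Suc p) y' c T"
    by auto
  let ?u = "\<lambda>c T. z c T - bd p y c T"
  have "koszul xs (?u c) T = 0" if "c < rk p" for c T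
  proof -
    have "koszul xs (?u c) T = bd p z' c T - bd p (\<lambda>c. koszul xs (y c)) c T"
      using z' that by (simp add: koszul_diff koszul_bd)
    also have "\<dots> = bd p (\<lambda>c T. z' c T - koszul xs (y c) T) c T" by (simp add: bd_diff)
    also have "\<dots> = bd p (bd (Suc p) y') c T" by (rule bd_cong) (use y in auto)
    finally show ?thesis using bd_bd[OF y(2) that] by simp
  qed
  moreover have "?u \<in> chains p (Suc q)" by (intro diff_chains z bd_chains y)
  ultimately obtain v where "v \<in> chains p (Suc (Suc q))" "\<forall>c<rk p. \<forall>T. ?u c T = koszul xs (v c) T"
    using koszul_exact_family[of ?u p "Suc q"] by auto
  then show ?case using y by (intro bexI[of _ v] bexI[of _ y]) (auto simp: algebra_simps)
qed

end

lemma homogeneous_system_nontrivial: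
  fixes \<kappa> :: "'s \<Rightarrow> nat \<Rightarrow> 'a::field"
  assumes "finite A" "n < card A"
  shows "\<exists>k. (\<exists>s\<in>A. k s \<noteq> 0) \<and> (\<forall>c<n. (\<Sum>s\<in>A. k s * \<kappa> s c) = 0)"
  using assms
proof (induction n arbitrary: A \<kappa>)
  case 0
  then show ?case by (intro exI[of _ "\<lambda>s. 1"]) (auto simp: card_gt_0_iff)
next
  case (Suc n)
  show ?case
  proof (cases "\<forall>s\<in>A. \<kappa> s n = 0")
    case True
    with Suc.IH[of A \<kappa>] Suc.prems show ?thesis by (auto simp: less_Suc_eq)
  next
    case False
    then obtain s0 where s0: "s0 \<in> A" "\<kappa> s0 n \<noteq> 0" by auto
    have "finite (A - {s0})" "n < card (A - {s0})" using Suc.prems s0 by auto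
    from Suc.IH[OF this, of "\<lambda>s c. \<kappa> s c - \<kappa> s n / \<kappa> s0 n * \<kappa> s0 c"]
    obtain k where k: "\<exists>s\<in>A - {s0}. k s \<noteq> 0"
      "\<And>c. c < n \<Longrightarrow> (\<Sum>s\<in>A - {s0}. k s * (\<kappa> s c - \<kappa> s n / \<kappa> s0 n * \<kappa> s0 c)) = 0"
      using Suc.IH[of "A - {s0}" "\<lambda>s c. \<kappa> s c - \<kappa> s n / \<kappa> s0 n * \<kappa> s0 c"] Suc.prems s0 by auto
    \<comment> \<open>The unknown \<open>s0\<close> has been eliminated from the other equations;
      its value is the one that equation \<open>n\<close> forces.\<close>
    define k' where "k' s = (if s = s0 then - (\<Sum>s\<in>A - {s0}. k s * \<kappa> s n) / \<kappa> s0 n else k s)" for s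
    have eq: "(\<Sum>s\<in>A. k' s * \<kappa> s c) = (\<Sum>s\<in>A - {s0}. k s * (\<kappa> s c - \<kappa> s n / \<kappa> s0 n * \<kappa> s0 c))" for c
    proof -
      have "(\<Sum>s\<in>A. k' s * \<kappa> s c) = k' s0 * \<kappa> s0 c + (\<Sum>s\<in>A - {s0}. k' s * \<kappa> s c)"
        using Suc.prems s0 by (simp add: sum.remove)
      also have "(\<Sum>s\<in>A - {s0}. k' s * \<kappa> s c) = (\<Sum>s\<in>A - {s0}. k s * \<kappa> s c)"
        by (intro sum.cong) (auto simp: k'_def)
      also have "k' s0 * \<kappa> s0 c = - (\<Sum>s\<in>A - {s0}. k s * (\<kappa> s n / \<kappa> s0 n * \<kappa> s0 c))"
        by (simp add: k'_def sum_distrib_right sum_divide_distrib mult.assoc)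
      finally show ?thesis by (simp only: right_diff_distrib sum_subtractf uminus_add_conv_diff)
    qed
    have "(\<Sum>s\<in>A. k' s * \<kappa> s c) = 0" if "c < Suc n" for c
    proof (cases "c = n")
      case True
      then show ?thesis unfolding eq using s0 by simp
    next
      case False
      then show ?thesis unfolding eq using k(2) that by simp
    qed
    moreover have "\<exists>s\<in>A. k' s \<noteq> 0" using k(1) by (auto simp: k'_def)
    ultimately show ?thesis by blast
  qed
qed

context minimal_exact_complex
begin

definition augmentation_ideal :: "('v, 'a) mpoly set" where
  "augmentation_ideal = {\<Sum>c<rk 1. a 0 0 c * w c | w. \<forall>c<rk 1. w c \<in> polys (set xs)}"

text \<open>
  If \<open>Y\<close> is a set of variables whose products with \<open>y\<close> lie in the ideal, then \<open>y e\<^sub>S\<close> for \<open>S \<subseteq> Y\<close> is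
  a Koszul cycle modulo the ideal. These cycles are independent modulo boundaries in degree
  \<open>card S > 0\<close>, because \<open>y e\<^sub>S\<close> can only come from a multiple of \<open>e\<^bsub>S \<union> {y}\<^esub>\<close>, whose boundary has further
  linear terms.
\<close>

lemma choose_le_rank:
  assumes rk0: "rk 0 = 1" and y: "y \<in> set xs" "y \<notin> Y" and Y: "Y \<subseteq> set xs"
    and products: "\<And>x. x \<in> Y \<Longrightarrow> var x * var y \<in> augmentation_ideal"
    and degree: "\<And>p x. p \<in> augmentation_ideal \<Longrightarrow> Poly_Mapping.lookup p (Poly_Mapping.single x 1) = 0"
    and q: "q > 0"
  shows "card Y choose q \<le> rk q"
proof (rule ccontr)
  assume less: "\<not> card Y choose q \<le> rk q"
  define A where "A = {S. S \<subseteq> Y \<and> card S = q}"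
  have finY: "finite Y" using Y finite_subset by blast
  then have A: "finite A" "card A = card Y choose q" by (auto simp: A_def n_subsets)
  obtain q' where q': "q = Suc q'" using q by (cases q) auto
  define z where "z S c T = (if T = S then var y else (0 :: ('v, 'a) mpoly))"
    for S and c :: nat and T :: "'v set"
  have z_chains: "z S \<in> chains 0 q" if "S \<in> A" for S
    using that Y y by (auto simp: chains_def koszul_chains_def z_def A_def)
  have "\<exists>w. (\<forall>c<rk 1. w c \<in> polys (set xs)) \<and> koszul xs (z S 0) T = (\<Sum>c<rk 1. a 0 0 c * w c)"
    if S: "S \<in> A" for S T
  proof (cases "\<exists>x\<in>set xs - T. insert x T = S")
    case True
    then obtain x where x: "x \<in> set xs" "x \<notin> T" "insert x T = S" by auto
    \<comment> \<open>The claim is generalised from \<open>xs\<close> to lists of its elements for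
      the induction along \<open>koszul\<close>. Only \<open>x\<close> contributes, and the
      accumulated signs go into \<open>\<epsilon>\<close>.\<close>
    have "\<exists>\<epsilon>. \<epsilon> \<in> polys (set xs) \<and> koszul ys (z S 0) T = \<epsilon> * (var x * var y)"
      if "set ys \<subseteq> set xs" "distinct ys" for ys
      using that
    proof (induction ys)
      case (Cons v ys)
      then obtain \<epsilon> where \<epsilon>: "\<epsilon> \<in> polys (set xs)" "koszul ys (z S 0) T = \<epsilon> * (var x * var y)" by auto
      consider "v \<in> T" | "v \<notin> T" "v = x" | "v \<notin> T" "v \<noteq> x" by blast
      then show ?case
      proof cases
        case 1
        then show ?thesis using \<epsilon> by (intro exI[of _ "- \<epsilon>"]) auto
      next
        case 2
        moreover have "z S 0 (insert x T) = var y" using x by (simp add: z_def)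
        ultimately show ?thesis using \<epsilon> by (intro exI[of _ "1 + \<epsilon>"]) (auto simp: algebra_simps)
      next
        case 3
        then have "z S 0 (insert v T) = 0" using x by (auto simp: z_def)
        then show ?thesis using \<epsilon> 3 by (intro exI[of _ \<epsilon>]) auto
      qed
    qed (auto intro: exI[of _ 0])
    then obtain \<epsilon> where \<epsilon>: "\<epsilon> \<in> polys (set xs)" "koszul xs (z S 0) T = \<epsilon> * (var x * var y)"
      using distinct_xs by blast
    have "x \<in> Y" using S x by (auto simp: A_def)
    with products obtain w where "\<forall>c<rk 1. w c \<in> polys (set xs)" "var x * var y = (\<Sum>c<rk 1. a 0 0 c * w c)"
      unfolding augmentation_ideal_def by blast
    then show ?thesis using \<epsilon>
      by (intro exI[of _ "\<lambda>c. \<epsilon> * w c"]) (auto simp: sum_distrib_left mult_ac)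
  next
    case False
    then have "koszul xs (z S 0) T = koszul xs (\<lambda>T. 0) T"
      by (intro koszul_cong) (auto simp: z_def)
    then show ?thesis by (intro exI[of _ "\<lambda>c. 0"]) auto
  qed
  then have "\<forall>S\<in>A. \<forall>T. \<exists>w. (\<forall>c<rk 1. w c \<in> polys (set xs)) \<and>
      koszul xs (z S 0) T = (\<Sum>c<rk 1. a 0 0 c * w c)" by blast
  then obtain w where w: "\<And>S T c. S \<in> A \<Longrightarrow> c < rk 1 \<Longrightarrow> w S T c \<in> polys (set xs)"
    "\<And>S T. S \<in> A \<Longrightarrow> koszul xs (z S 0) T = (\<Sum>c<rk 1. a 0 0 c * w S T c)"
    unfolding choice_iff bchoice_iff by blast
  have "\<exists>u. zigzag q 0 (z S) u" if S: "S \<in> A" for S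
  proof -
    \<comment> \<open>The stair that leaves position 0 is built by hand: there, membership of the
      coefficients in the ideal replaces exactness. The lifts \<open>w\<close> are cut down to
      Koszul degree \<open>q' = q - 1\<close>.\<close>
    define z' where "z' c T = (if T \<subseteq> set xs \<and> card T = q' then w S T c else 0)" for c T
    have z': "z' \<in> chains 1 q'" using w S by (auto simp: chains_def koszul_chains_def z'_def)
    have d: "koszul xs (z S 0) T = bd 0 z' 0 T" for T
    proof (cases "T \<subseteq> set xs \<and> card T = q'")
      case True
      then show ?thesis using w S by (simp add: bd_def z'_def)
    next
      case False
      have "(\<lambda>c. koszul xs (z S c)) \<in> chains 0 q'"
        using z_chains[OF S] unfolding q' by (rule koszul_chains_family)
      then have "koszul xs (z S 0) T = 0"
        using False rk0 unfolding chains_def koszul_chains_def by auto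
      moreover have "z' c T = 0" for c using False by (auto simp: z'_def)
      ultimately show ?thesis by (simp add: bd_def)
    qed
    have "bd 0 (\<lambda>c. koszul xs (z' c)) r T = 0" if "r < rk 0" for r T
    proof -
      have "koszul xs (bd 0 z' 0) T = koszul xs (koszul xs (z S 0)) T"
        by (rule koszul_cong) (simp add: d)
      then show ?thesis using koszul_koszul[OF distinct_xs] that rk0 by (metis koszul_bd less_one)
    qed
    then obtain u where "zigzag q' 1 z' u"
      using zigzag_exists[of z' 0 q'] z' by auto
    then show ?thesis using z_chains[OF S] d rk0 unfolding q' by auto
  qed
  then obtain u where u: "\<And>S. S \<in> A \<Longrightarrow> zigzag q 0 (z S) (u S)" by metis
  obtain k where k: "\<exists>S\<in>A. k S \<noteq> 0"
    "\<And>c. c < rk q \<Longrightarrow> (\<Sum>S\<in>A. k S * Poly_Mapping.lookup (u S c {}) 0) = 0"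
    using homogeneous_system_nontrivial[of A "rk q" "\<lambda>S c. Poly_Mapping.lookup (u S c {}) 0"] A less
    by auto
  let ?k = "\<lambda>S. Poly_Mapping.single 0 (k S)"
  have "zigzag q 0 (\<lambda>c T. \<Sum>S\<in>A. ?k S * z S c T) (\<lambda>c T. \<Sum>S\<in>A. ?k S * u S c T)"
    by (rule zigzag_sum) (use u in auto)
  then obtain v v' where v: "v \<in> chains 0 (Suc q)" "v' \<in> chains 1 q"
    "\<And>T. (\<Sum>S\<in>A. ?k S * z S 0 T) = koszul xs (v 0) T + bd 0 v' 0 T"
    using zigzag_boundary[of q 0 "\<lambda>c T. \<Sum>S\<in>A. ?k S * z S c T" "\<lambda>c T. \<Sum>S\<in>A. ?k S * u S c T"] k(2) rk0
    by (auto simp: lookup_sum lookup_mult_0)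
  have "bd 0 v' 0 T \<in> augmentation_ideal" for T
    using v(2) by (auto simp: augmentation_ideal_def bd_def chains_def koszul_chains_def)
  \<comment> \<open>The ideal has no linear terms, so linear coefficients can be compared as if the
    combination were a genuine Koszul boundary.\<close>
  then have linear: "Poly_Mapping.lookup (\<Sum>S\<in>A. ?k S * z S 0 T) (Poly_Mapping.single x 1) =
      Poly_Mapping.lookup (koszul xs (v 0) T) (Poly_Mapping.single x 1)" for x T
    using degree v(3) by (simp add: lookup_add)
  have combination: "(\<Sum>S\<in>A. ?k S * z S 0 T) = (if T \<in> A then ?k T * var y else 0)" for T
    using A(1) by (simp add: z_def if_distrib sum.delta cong: if_cong)
  obtain S where S: "S \<in> A" "k S \<noteq> 0" using k(1) by blast
  then have S': "S \<subseteq> Y" "card S = q" "y \<notin> S" using y by (auto simp: A_def)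
  have "Poly_Mapping.lookup (?k S * var y) (Poly_Mapping.single y 1) = k S"
    using lookup_single_mult[of 0 "k S" "var y" "Poly_Mapping.single y 1"] by (simp add: var_def)
  then have "Poly_Mapping.lookup (koszul xs (v 0) S) (Poly_Mapping.single y 1) \<noteq> 0"
    using linear[of S y] S combination by simp
  then have nz: "Poly_Mapping.lookup (v 0 (insert y S)) 0 \<noteq> 0"
    using lookup_koszul_single[OF distinct_xs y(1) S'(3), of "v 0"] by auto
  obtain s where s: "s \<in> S" using S' q by fastforce
  \<comment> \<open>The constant term of \<open>v 0 (insert y S)\<close> shows up twice in the
    boundary, up to sign: as the coefficient of \<open>y\<close> at \<open>S\<close>, where it must
    be \<open>k S \<noteq> 0\<close>, and as the coefficient of \<open>s\<close> at
    \<open>?T\<close>, where the combination vanishes because \<open>?T\<close> contains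
    \<open>y\<close>.\<close>
  let ?T = "insert y (S - {s})"
  have "?T \<notin> A" using y by (auto simp: A_def)
  then have "Poly_Mapping.lookup (koszul xs (v 0) ?T) (Poly_Mapping.single s 1) = 0"
    using linear[of ?T s] combination by simp
  moreover have "s \<in> set xs" "s \<notin> ?T" "insert s ?T = insert y S" using s S' Y by auto
  ultimately have "Poly_Mapping.lookup (v 0 (insert y S)) 0 = 0"
    using lookup_koszul_single[OF distinct_xs, of s ?T "v 0"] by auto
  with nz show False by contradiction
qed

end

section \<open>Finite generation\<close>

lemma nat_seq_incseq_subseq:
  fixes s :: "nat \<Rightarrow> nat"
  shows "\<exists>h::nat \<Rightarrow> nat. strict_mono h \<and> (\<forall>i j. i \<le> j \<longrightarrow> s (h i) \<le> s (h j))"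
proof -
  obtain f where f: "strict_mono f" "monoseq (\<lambda>n. s (f n))" using seq_monosub by blast
  show ?thesis
  proof (cases "incseq (\<lambda>n. s (f n))")
    case True
    then show ?thesis using f(1) by (intro exI[of _ f]) (auto simp: incseq_def)
  next
    case False
    then have dec: "s (f j) \<le> s (f i)" if "i \<le> j" for i j
      using f(2) that by (auto simp: monoseq_iff decseq_def)
    \<comment> \<open>A nonincreasing sequence of natural numbers is constant once it has reached
      its minimum.\<close>
    define N where "N = (ARG_MIN (\<lambda>n. s (f n)) n. True)"
    have "s (f N) \<le> s (f n)" for n unfolding N_def by (rule arg_min_nat_le) simp
    then have "s (f (N + i)) = s (f N)" for i using dec[of N "N + i"] by (simp add: antisym)
    moreover have "strict_mono (\<lambda>i. f (N + i))"
      using f(1) by (simp add: strict_mono_def)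
    ultimately show ?thesis by (intro exI[of _ "\<lambda>i. f (N + i)"]) simp
  qed
qed

text \<open>The variables are treated one at a time, each by passing to a subsequence on which its
  exponent is nondecreasing.\<close>

lemma dickson_pair:
  fixes f :: "nat \<Rightarrow> 'v monomial"
  assumes "finite V"
  shows "\<exists>i j. i < j \<and> (\<forall>x\<in>V. Poly_Mapping.lookup (f i) x \<le> Poly_Mapping.lookup (f j) x)"
proof -
  have "\<exists>g::nat \<Rightarrow> nat. strict_mono g \<and>
      (\<forall>x\<in>V. \<forall>i j. i \<le> j \<longrightarrow> Poly_Mapping.lookup (f (g i)) x \<le> Poly_Mapping.lookup (f (g j)) x)"
    using assms
  proof (induction V rule: finite_induct)
    case empty
    show ?case by (intro exI[of _ id]) (simp add: strict_mono_def)
  next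
    case (insert x V)
    from insert.IH obtain g :: "nat \<Rightarrow> nat" where g: "strict_mono g"
      "\<forall>x\<in>V. \<forall>i j. i \<le> j \<longrightarrow> Poly_Mapping.lookup (f (g i)) x \<le> Poly_Mapping.lookup (f (g j)) x"
      by (elim exE conjE) (rule that)
    let ?s = "\<lambda>i. Poly_Mapping.lookup (f (g i)) x"
    obtain h :: "nat \<Rightarrow> nat" where h: "strict_mono h" "\<forall>i j. i \<le> j \<longrightarrow> ?s (h i) \<le> ?s (h j)"
      using nat_seq_incseq_subseq[of ?s] by (elim exE conjE) (rule that)
    show ?case
    proof (intro exI[of _ "g \<circ> h"] conjI ballI allI impI)
      show "strict_mono (g \<circ> h)" using g(1) h(1) by (rule strict_mono_o)
    next
      fix x' i j assume "x' \<in> insert x V" "i \<le> (j::nat)"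
      moreover from this have "h i \<le> h j" using h(1) by (simp add: strict_mono_less_eq)
      ultimately show "Poly_Mapping.lookup (f ((g \<circ> h) i)) x' \<le> Poly_Mapping.lookup (f ((g \<circ> h) j)) x'"
        using g(2) h(2) by auto
    qed
  qed
  then obtain g :: "nat \<Rightarrow> nat" where g: "strict_mono g"
    "\<forall>x\<in>V. \<forall>i j. i \<le> j \<longrightarrow> Poly_Mapping.lookup (f (g i)) x \<le> Poly_Mapping.lookup (f (g j)) x"
    by (elim exE conjE) (rule that)
  show ?thesis
    by (intro exI[of _ "g 0"] exI[of _ "g 1"]) (use g strict_mono_less[OF g(1), of 0 1] in auto)
qed

text \<open>\<open>B\<close> consists of the members minimal under divisibility. Infinitely many of
  them would contain a pair as in \<open>dickson_pair\<close>, and descending in total degree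
  reaches one from any member of \<open>M\<close>.\<close>

lemma dickson:
  fixes M :: "'v monomial set"
  assumes "finite V" "\<And>m. m \<in> M \<Longrightarrow> Poly_Mapping.keys m \<subseteq> V"
  shows "\<exists>B\<subseteq>M. finite B \<and> (\<forall>m\<in>M. \<exists>b\<in>B. \<exists>d. m = b + d)"
proof -
  define B where "B = {m \<in> M. \<forall>b\<in>M. \<forall>d. m = b + d \<longrightarrow> d = 0}"
  have add_le: "\<exists>d. m' = m + d" if "\<forall>x\<in>V. Poly_Mapping.lookup m x \<le> Poly_Mapping.lookup m' x" "m \<in> M" for m m'
  proof (intro exI poly_mapping_eqI)
    fix x
    have "Poly_Mapping.lookup m x \<le> Poly_Mapping.lookup m' x"
    proof (cases "x \<in> V")
      case False
      then have "x \<notin> Poly_Mapping.keys m" using assms(2)[OF that(2)] by blast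
      then show ?thesis by (simp add: in_keys_iff)
    qed (use that in blast)
    then show "Poly_Mapping.lookup m' x = Poly_Mapping.lookup (m + (m' - m)) x"
      by (simp add: lookup_add lookup_minus)
  qed
  have "finite B"
  proof (rule ccontr)
    assume "infinite B"
    then obtain f :: "nat \<Rightarrow> 'v monomial" where f: "inj f" "range f \<subseteq> B"
      using infinite_countable_subset by blast
    obtain i j where ij: "i < j" "\<forall>x\<in>V. Poly_Mapping.lookup (f i) x \<le> Poly_Mapping.lookup (f j) x"
      using dickson_pair[OF assms(1)] by blast
    have "f i \<in> M" "f j \<in> B" using f by (auto simp: B_def)
    with add_le[OF ij(2)] obtain d where "f j = f i + d" by blast
    then have "f j = f i" using \<open>f i \<in> M\<close> \<open>f j \<in> B\<close> by (auto simp: B_def)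
    then show False using f(1) ij(1) by (auto dest: injD)
  qed
  moreover have "\<exists>b\<in>B. \<exists>d. m = b + d" if "m \<in> M" for m
    using that
  proof (induction "\<Sum>x\<in>V. Poly_Mapping.lookup m x" arbitrary: m rule: less_induct)
    case less
    show ?case
    proof (cases "m \<in> B")
      case True
      then show ?thesis by (intro bexI[of _ m] exI[of _ 0]) auto
    next
      case False
      then obtain b d where bd: "b \<in> M" "m = b + d" "d \<noteq> 0" using less.prems by (auto simp: B_def)
      then obtain x where "x \<in> Poly_Mapping.keys d" using keys_eq_empty[of d] by blast
      moreover have "Poly_Mapping.keys d \<subseteq> V" using assms(2)[OF less.prems] bd by (auto simp: keys_monomial_add)
      ultimately have "x \<in> V" "Poly_Mapping.lookup d x > 0" by (auto simp: in_keys_iff)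
      then have "(\<Sum>x\<in>V. Poly_Mapping.lookup b x) < (\<Sum>x\<in>V. Poly_Mapping.lookup m x)"
        using assms(1) unfolding bd by (intro sum_strict_mono_ex1) (auto simp: lookup_add)
      from less.hyps[OF this bd(1)] obtain b' d' where "b' \<in> B" "b = b' + d'" by blast
      then show ?thesis using bd by (intro bexI[of _ b'] exI[of _ "d' + d"]) (auto simp: add.assoc)
    qed
  qed
  ultimately show ?thesis by (intro exI[of _ B]) (auto simp: B_def)
qed

text \<open>Here \<open><\<close> is the generic linear order on finitely supported functions, used
  for leading terms, and not the reverse lexicographic order of the statement. A descending sequence
  would contain \<open>i < j\<close> with \<open>f i\<close> dividing \<open>f j\<close>, whereas
  \<open>f j < f i\<close> forces some exponent to drop.\<close>

lemma monomial_induct [consumes 2, case_names less]: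
  fixes m :: "'v::linorder monomial"
  assumes "finite V" "Poly_Mapping.keys m \<subseteq> V"
    and "\<And>m. Poly_Mapping.keys m \<subseteq> V \<Longrightarrow> (\<And>m'. Poly_Mapping.keys m' \<subseteq> V \<Longrightarrow> m' < m \<Longrightarrow> P m') \<Longrightarrow> P m"
  shows "P m"
proof -
  define R where "R = {(m', m). Poly_Mapping.keys m' \<subseteq> V \<and> Poly_Mapping.keys m \<subseteq> V \<and> m' < (m :: 'v monomial)}"
  have "wf R"
    unfolding wf_iff_no_infinite_down_chain
  proof
    assume "\<exists>f. \<forall>i. (f (Suc i), f i) \<in> R"
    then obtain f where f: "\<And>i. (f (Suc i), f i) \<in> R" by blast
    have decr: "f j < f i" if "i < j" for i j
      using that
    proof (induction j)
      case (Suc j)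
      have "f (Suc j) < f j" using f[of j] by (simp add: R_def)
      then show ?case using Suc by (cases "i = j") (auto intro: less_trans)
    qed simp
    obtain i j where ij: "i < j" "\<forall>x\<in>V. Poly_Mapping.lookup (f i) x \<le> Poly_Mapping.lookup (f j) x"
      using dickson_pair[OF assms(1)] by blast
    have "f j < f i" using decr ij by blast
    then obtain x where "Poly_Mapping.lookup (f j) x < Poly_Mapping.lookup (f i) x"
      by (auto simp: less_poly_mapping.rep_eq less_fun_def)
    moreover from this have "x \<in> V" using f[of i] by (auto simp: R_def in_keys_iff)
    ultimately show False using ij(2) by (auto simp: not_le[symmetric])
  qed
  then show ?thesis using assms(2)
  proof (induction m rule: wf_induct_rule)
    case (less m)
    show ?case
    proof (rule assms(3)[OF less.prems])
      fix m' assume "Poly_Mapping.keys m' \<subseteq> V" "m' < m"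
      then show "P m'" using less by (auto simp: R_def)
    qed
  qed
qed

section \<open>Submodules of finite free modules and their finite generation\<close>

inductive_set module_span :: "'v set \<Rightarrow> (nat \<Rightarrow> ('v, 'a::field) mpoly) set \<Rightarrow> (nat \<Rightarrow> ('v, 'a) mpoly) set"
  for V :: "'v set" and G :: "(nat \<Rightarrow> ('v, 'a::field) mpoly) set" where
  zero: "(\<lambda>c. 0) \<in> module_span V G"
| step: "g \<in> G \<Longrightarrow> k \<in> polys V \<Longrightarrow> u \<in> module_span V G \<Longrightarrow> (\<lambda>c. k * g c + u c) \<in> module_span V G"

text \<open>Vectors of length \<open>n\<close> are functions on all natural numbers that vanish from
  \<open>n\<close> on. Submodules of different ranks thus share one type, as the induction on
  \<open>n\<close> below requires.\<close>

definition free_submodule :: "'v set \<Rightarrow> nat \<Rightarrow> (nat \<Rightarrow> ('v, 'a::field) mpoly) set \<Rightarrow> bool" where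
  "free_submodule V n M \<longleftrightarrow>
     (\<forall>u\<in>M. \<forall>c. u c \<in> polys V \<and> (c \<ge> n \<longrightarrow> u c = 0)) \<and> (\<lambda>c. 0) \<in> M \<and>
     (\<forall>u\<in>M. \<forall>v\<in>M. (\<lambda>c. u c + v c) \<in> M) \<and> (\<forall>k\<in>polys V. \<forall>u\<in>M. (\<lambda>c. k * u c) \<in> M)"

lemma
  assumes "free_submodule V n M"
  shows free_submodule_polys: "u \<in> M \<Longrightarrow> u c \<in> polys V"
    and free_submodule_support: "u \<in> M \<Longrightarrow> c \<ge> n \<Longrightarrow> u c = 0"
    and free_submodule_zero: "(\<lambda>c. 0) \<in> M"
    and free_submodule_add: "u \<in> M \<Longrightarrow> v \<in> M \<Longrightarrow> (\<lambda>c. u c + v c) \<in> M"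
    and free_submodule_scale: "k \<in> polys V \<Longrightarrow> u \<in> M \<Longrightarrow> (\<lambda>c. k * u c) \<in> M"
  using assms unfolding free_submodule_def by blast+

lemma module_span_subset:
  assumes "free_submodule V n M" "G \<subseteq> M"
  shows "module_span V G \<subseteq> M"
proof
  fix u assume "u \<in> module_span V G"
  then show "u \<in> M"
  proof induction
    case zero
    show ?case using assms(1) by (rule free_submodule_zero)
  next
    case (step g k u)
    then show ?case
      using assms free_submodule_add[OF assms(1) free_submodule_scale[OF assms(1)], of k g u] by auto
  qed
qed

lemma module_span_add:
  assumes "u \<in> module_span V G" "v \<in> module_span V G"
  shows "(\<lambda>c. u c + v c) \<in> module_span V G"
  using assms(1)
proof induction
  case zero
  show ?case using assms(2) by simp
next
  case (step g k u)
  then show ?case using module_span.step[of g G k V "\<lambda>c. u c + v c"] by (simp add: add.assoc)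
qed

lemma module_span_scale:
  assumes "u \<in> module_span V G" "k \<in> polys V"
  shows "(\<lambda>c. k * u c) \<in> module_span V G"
  using assms(1)
proof induction
  case zero
  show ?case using module_span.zero by simp
next
  case (step g k' u)
  then show ?case
    using module_span.step[of g G "k * k'" V "\<lambda>c. k * u c"] assms(2) by (auto simp: algebra_simps)
qed

lemma module_span_base:
  assumes "g \<in> G"
  shows "g \<in> module_span V G"
  using module_span.step[OF assms polys_1 module_span.zero] by simp

lemma module_span_sum:
  "(\<And>i. i \<in> A \<Longrightarrow> f i \<in> module_span V G) \<Longrightarrow> (\<lambda>c. \<Sum>i\<in>A. f i c) \<in> module_span V G"
  by (induction A rule: infinite_finite_induct) (auto intro: module_span.zero module_span_add)

lemma module_span_trans:
  assumes "G \<subseteq> module_span V H"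
  shows "module_span V G \<subseteq> module_span V H"
proof
  fix u assume "u \<in> module_span V G"
  then show "u \<in> module_span V H"
  proof induction
    case (step g k u)
    then have "(\<lambda>c. k * g c) \<in> module_span V H" using assms by (intro module_span_scale) auto
    then show ?case using step by (intro module_span_add)
  qed (rule module_span.zero)
qed

lemma module_span_mono: "G \<subseteq> H \<Longrightarrow> module_span V G \<subseteq> module_span V H"
  by (rule module_span_trans) (auto intro: module_span_base)

lemma leading_term_cancel:
  fixes p q :: "('v::linorder, 'a::field) mpoly" and d :: "'v monomial"
  defines "p' \<equiv> p - Poly_Mapping.single d (Poly_Mapping.lookup p (Max (Poly_Mapping.keys p)) /
      Poly_Mapping.lookup q (Max (Poly_Mapping.keys q))) * q"
  assumes "p \<noteq> 0" "q \<noteq> 0" "Max (Poly_Mapping.keys p) = Max (Poly_Mapping.keys q) + d" "p' \<noteq> 0"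
  shows "Max (Poly_Mapping.keys p') < Max (Poly_Mapping.keys p)"
proof -
  let ?l = "\<lambda>p. Max (Poly_Mapping.keys p)"
  let ?c = "Poly_Mapping.lookup p (?l p) / Poly_Mapping.lookup q (?l q)"
  have "?l q \<in> Poly_Mapping.keys q" using assms by simp
  then have "Poly_Mapping.lookup p' (?l p) = 0"
    using assms(4) lookup_single_mult[of d ?c q "?l q"]
    by (simp add: p'_def lookup_minus in_keys_iff add.commute)
  moreover have "m \<le> ?l p" if "m \<in> Poly_Mapping.keys p'" for m
  proof -
    have "m \<in> Poly_Mapping.keys p \<or> m \<in> Poly_Mapping.keys (Poly_Mapping.single d ?c * q)"
      using that keys_diff[of p "Poly_Mapping.single d ?c * q"] unfolding p'_def by auto
    then show ?thesis
    proof
      assume "m \<in> Poly_Mapping.keys (Poly_Mapping.single d ?c * q)"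
      then obtain m' where "m = d + m'" "m' \<in> Poly_Mapping.keys q"
        using keys_single_mult by blast
      then show ?thesis using assms(4) by (simp add: add.commute[of d] add_right_mono)
    qed simp
  qed
  moreover have "?l p' \<in> Poly_Mapping.keys p'" using assms(5) by simp
  ultimately show ?thesis by (metis in_keys_iff order_le_less)
qed

text \<open>Induction on the rank through the last coordinate. By Dickson's lemma finitely many
  vectors \<open>H\<close> have last coordinates whose leading monomials divide all those that
  occur. Division by \<open>H\<close> makes the last coordinate 0, and the vectors with this
  property form a submodule of smaller rank.\<close>

lemma free_submodule_finitely_generated:
  fixes M :: "(nat \<Rightarrow> ('v::linorder, 'a::field) mpoly) set"
  assumes "finite V" "free_submodule V n M"
  shows "\<exists>G\<subseteq>M. finite G \<and> M \<subseteq> module_span V G"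
  using assms(2)
proof (induction n arbitrary: M)
  case 0
  then have "u = (\<lambda>c. 0)" if "u \<in> M" for u
    using free_submodule_support[OF 0 that] by auto
  then show ?case by (intro exI[of _ "{}"]) (auto intro: module_span.zero)
next
  case (Suc n)
  note M = Suc.prems
  let ?l = "\<lambda>u :: nat \<Rightarrow> ('v, 'a) mpoly. Max (Poly_Mapping.keys (u n))"
  let ?S = "?l ` {u \<in> M. u n \<noteq> 0}"
  have keys_l: "Poly_Mapping.keys (?l u) \<subseteq> V" if "u \<in> M" "u n \<noteq> 0" for u
    using free_submodule_polys[OF M that(1), of n] that(2) by (simp add: polys_iff)
  then have "\<And>m. m \<in> ?S \<Longrightarrow> Poly_Mapping.keys m \<subseteq> V" by auto
  then have "\<exists>B\<subseteq>?S. finite B \<and> (\<forall>m\<in>?S. \<exists>b\<in>B. \<exists>d. m = b + d)"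
    by (intro dickson[OF assms(1)])
  then obtain B where B: "B \<subseteq> ?S" "finite B" "\<forall>m\<in>?S. \<exists>b\<in>B. \<exists>d. m = b + d"
    by (elim exE conjE) (rule that)
  from finite_subset_image[OF B(2,1)] obtain H where H: "H \<subseteq> {u \<in> M. u n \<noteq> 0}" "finite H" "B = ?l ` H"
    by (elim exE conjE) (rule that)
  have top: "\<exists>v\<in>module_span V H. \<exists>u'\<in>M. u' n = 0 \<and> u = (\<lambda>c. u' c + v c)" if "u \<in> M" for u
  proof (cases "u n = 0")
    case True
    then show ?thesis using that by (intro bexI[of _ "\<lambda>c. 0"] bexI[of _ u]) (auto intro: module_span.zero)
  next
    case False
    define m where "m = ?l u"
    have "Poly_Mapping.keys m \<subseteq> V" using keys_l that False by (simp add: m_def)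
    with assms(1) show ?thesis using that False m_def
    proof (induction m arbitrary: u rule: monomial_induct)
      case (less m)
      then have "m \<in> ?S" by auto
      then obtain b d where b: "b \<in> B" "m = b + d" using B(3) by blast
      then obtain h where h: "h \<in> H" "b = ?l h" using H(3) by auto
      let ?k = "Poly_Mapping.single d (Poly_Mapping.lookup (u n) (?l u) / Poly_Mapping.lookup (h n) (?l h))"
      define u1 where "u1 c = u c - ?k * h c" for c
      have k: "?k \<in> polys V"
        using less.hyps(1) b by (intro polys_single) (auto simp: keys_monomial_add)
      have hM: "h \<in> M" "h n \<noteq> 0" using H h by auto
      have "(\<lambda>c. u c + (- ?k) * h c) \<in> M"
        by (intro free_submodule_add[OF M] free_submodule_scale[OF M] polys_uminus less.prems k hM)
      then have u1M: "u1 \<in> M" by (simp add: u1_def[abs_def])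
      have "\<exists>v\<in>module_span V H. \<exists>u'\<in>M. u' n = 0 \<and> u1 = (\<lambda>c. u' c + v c)"
      proof (cases "u1 n = 0")
        case True
        then show ?thesis using u1M
          by (intro bexI[of _ "\<lambda>c. 0"] bexI[of _ u1]) (auto intro: module_span.zero)
      next
        case False
        have "?l u1 < m"
          using leading_term_cancel[of "u n" "h n" d] less.prems hM b h False by (auto simp: u1_def)
        moreover have "Poly_Mapping.keys (?l u1) \<subseteq> V" using keys_l u1M False by blast
        ultimately show ?thesis using less.IH[of "?l u1" u1] u1M False by blast
      qed
      then obtain v u' where v: "v \<in> module_span V H" "u' \<in> M" "u' n = 0" "u1 = (\<lambda>c. u' c + v c)"
        by (elim bexE conjE) (rule that)
      have "u = (\<lambda>c. u' c + (?k * h c + v c))"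
      proof
        show "u c = u' c + (?k * h c + v c)" for c
          using fun_cong[OF v(4), of c] unfolding u1_def by (simp add: algebra_simps)
      qed
      then show ?case
        by (intro bexI[OF _ module_span.step[OF h(1) k v(1)]] bexI[OF _ v(2)] conjI v(3))
    qed
  qed
  let ?M' = "{u \<in> M. u n = 0}"
  have M': "free_submodule V n ?M'"
  proof -
    have "u c = 0" if "u \<in> M" "u n = 0" "n \<le> c" for u c
      using that free_submodule_support[OF M, of u c] by (cases "c = n") auto
    then show ?thesis using M unfolding free_submodule_def by auto
  qed
  obtain G where G: "G \<subseteq> ?M'" "finite G" "?M' \<subseteq> module_span V G" using Suc.IH[OF M'] by blast
  have "M \<subseteq> module_span V (G \<union> H)"
  proof
    fix u assume "u \<in> M"
    from top[OF this] obtain v u' where v: "v \<in> module_span V H" "u' \<in> M" "u' n = 0" "u = (\<lambda>c. u' c + v c)"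
      by (elim bexE conjE) (rule that)
    then have "v \<in> module_span V (G \<union> H)" "u' \<in> module_span V (G \<union> H)"
      using G module_span_mono[of G "G \<union> H" V] module_span_mono[of H "G \<union> H" V] by auto
    then show "u \<in> module_span V (G \<union> H)" using v(4) module_span_add by simp
  qed
  then show ?case using G H by (intro exI[of _ "G \<union> H"]) auto
qed

section \<open>Existence of minimal graded free resolutions\<close>

lemma mdeg_eq_sum:
  assumes "finite X" "Poly_Mapping.keys m \<subseteq> X"
  shows "mdeg m = (\<Sum>x\<in>X. Poly_Mapping.lookup m x)"
  unfolding mdeg_def using assms by (intro sum.mono_neutral_left) (auto simp: in_keys_iff)

lemma mdeg_add: "mdeg (a + b :: 'v monomial) = mdeg a + mdeg b"
  using mdeg_eq_sum[of "Poly_Mapping.keys a \<union> Poly_Mapping.keys b"]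
  by (simp add: lookup_add sum.distrib keys_monomial_add)

lemma mdeg_eq_0_iff: "mdeg m = 0 \<longleftrightarrow> m = 0"
  by (auto simp: mdeg_def in_keys_iff intro!: poly_mapping_eqI)

lemma mdeg_single: "mdeg (Poly_Mapping.single x n) = n"
  by (simp add: mdeg_def)

text \<open>The component of degree \<open>e\<close> in the graded free module whose
  \<open>c\<close>-th basis element has degree \<open>s c\<close>.\<close>

definition hom_part :: "(nat \<Rightarrow> nat) \<Rightarrow> nat \<Rightarrow> (nat \<Rightarrow> ('v, 'a::field) mpoly) \<Rightarrow> nat \<Rightarrow> ('v, 'a) mpoly" where
  "hom_part s e u c = filter_poly (\<lambda>m. mdeg m + s c = e) (u c)"

definition graded_submodule :: "'v set \<Rightarrow> nat \<Rightarrow> (nat \<Rightarrow> nat) \<Rightarrow> (nat \<Rightarrow> ('v, 'a::field) mpoly) set \<Rightarrow> bool" where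
  "graded_submodule V n s M \<longleftrightarrow> free_submodule V n M \<and> (\<forall>u\<in>M. \<forall>e. hom_part s e u \<in> M)"

definition homogeneous_matrix ::
    "'v set \<Rightarrow> nat \<Rightarrow> (nat \<Rightarrow> nat) \<Rightarrow> nat list \<Rightarrow> (nat \<Rightarrow> nat \<Rightarrow> ('v, 'a::field) mpoly) \<Rightarrow> bool" where
  "homogeneous_matrix V n s t A \<longleftrightarrow> (\<forall>r<n. \<forall>c<length t.
     A r c \<in> polys V \<and> (\<forall>m\<in>Poly_Mapping.keys (A r c). mdeg m + s r = t ! c))"

definition syzygies :: "'v set \<Rightarrow> nat \<Rightarrow> nat \<Rightarrow> (nat \<Rightarrow> nat \<Rightarrow> ('v, 'a::field) mpoly) \<Rightarrow> (nat \<Rightarrow> ('v, 'a) mpoly) set" where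
  "syzygies V n n' A = {u. (\<forall>c<n'. u c \<in> polys V) \<and> (\<forall>c\<ge>n'. u c = 0) \<and> (\<forall>r<n. (\<Sum>c<n'. A r c * u c) = 0)}"

definition column_span :: "'v set \<Rightarrow> nat \<Rightarrow> nat \<Rightarrow> (nat \<Rightarrow> nat \<Rightarrow> ('v, 'a::field) mpoly) \<Rightarrow> (nat \<Rightarrow> ('v, 'a) mpoly) set" where
  "column_span V n n' A = {\<lambda>r. if r < n then \<Sum>c<n'. A r c * w c else 0 | w. \<forall>c<n'. w c \<in> polys V}"

lemma filter_poly_mult:
  assumes "\<And>m. m \<in> Poly_Mapping.keys a \<Longrightarrow> mdeg m + i = j"
  shows "filter_poly (\<lambda>m. mdeg m + i = e) (a * p) = a * filter_poly (\<lambda>m. mdeg m + j = e) p"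
proof -
  let ?P = "\<lambda>m. mdeg m + i = e" and ?Q = "\<lambda>m. mdeg m + j = e"
  have iff: "?P m \<longleftrightarrow> ?Q m2" if "m = m1 + m2" "m1 \<in> Poly_Mapping.keys a" for m m1 m2
    using assms[OF that(2)] that(1) by (auto simp: mdeg_add)
  have "filter_poly ?P (a * p) = filter_poly ?P (a * filter_poly ?Q p) +
      filter_poly ?P (a * filter_poly (\<lambda>m. \<not> ?Q m) p)"
    by (simp add: filter_poly_split flip: filter_poly_add distrib_left)
  moreover have "filter_poly ?P (a * filter_poly ?Q p) = a * filter_poly ?Q p"
  proof (rule filter_poly_id)
    fix m assume "m \<in> Poly_Mapping.keys (a * filter_poly ?Q p)"
    then show "?P m" using keys_mult[of a "filter_poly ?Q p"] iff by (auto simp: keys_filter_poly)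
  qed
  moreover have "filter_poly ?P (a * filter_poly (\<lambda>m. \<not> ?Q m) p) = 0"
  proof (rule filter_poly_none)
    fix m assume "m \<in> Poly_Mapping.keys (a * filter_poly (\<lambda>m. \<not> ?Q m) p)"
    then show "\<not> ?P m" using keys_mult[of a "filter_poly (\<lambda>m. \<not> ?Q m) p"] iff by (auto simp: keys_filter_poly)
  qed
  ultimately show ?thesis by simp
qed

lemma hom_part_syzygies:
  assumes "homogeneous_matrix V n s t A" "r < n" "(\<Sum>c<length t. A r c * u c) = 0"
  shows "(\<Sum>c<length t. A r c * hom_part (nth t) e u c) = 0"
proof -
  have "(\<Sum>c<length t. A r c * hom_part (nth t) e u c) =
      (\<Sum>c<length t. filter_poly (\<lambda>m. mdeg m + s r = e) (A r c * u c))"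
    unfolding hom_part_def
    by (intro sum.cong refl filter_poly_mult[symmetric]) (use assms in \<open>auto simp: homogeneous_matrix_def\<close>)
  also have "\<dots> = filter_poly (\<lambda>m. mdeg m + s r = e) (\<Sum>c<length t. A r c * u c)"
    by (simp add: filter_poly_sum)
  finally show ?thesis using assms(3) by simp
qed

lemma graded_submodule_syzygies:
  assumes "homogeneous_matrix V n s t A"
  shows "graded_submodule V (length t) (nth t) (syzygies V n (length t) A)"
proof -
  have polys: "u c \<in> polys V" if "u \<in> syzygies V n (length t) A" for u c
    using that by (cases "c < length t") (auto simp: syzygies_def)
  have "free_submodule V (length t) (syzygies V n (length t) A)"
    unfolding free_submodule_def using polys
    by (auto simp: syzygies_def distrib_left sum.distrib mult.left_commute[of "A _ _"] simp flip: sum_distrib_left)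
  moreover have "hom_part (nth t) e u \<in> syzygies V n (length t) A" if "u \<in> syzygies V n (length t) A" for e u
    using that hom_part_syzygies[OF assms] by (auto simp: syzygies_def) (auto simp: hom_part_def)
  ultimately show ?thesis by (simp add: graded_submodule_def)
qed

lemma hom_part_decomposition:
  assumes "\<And>c. c \<ge> n \<Longrightarrow> u c = 0"
  shows "\<exists>E. finite E \<and> u = (\<lambda>c. \<Sum>e\<in>E. hom_part s e u c)"
proof (intro exI conjI ext)
  let ?E = "\<Union>c<n. (\<lambda>m. mdeg m + s c) ` Poly_Mapping.keys (u c)"
  show fin: "finite ?E" by simp
  show "u c = (\<Sum>e\<in>?E. hom_part s e u c)" for c
  proof (rule poly_mapping_eqI)
    fix m
    have "(\<Sum>e\<in>?E. Poly_Mapping.lookup (hom_part s e u c) m) =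
        (\<Sum>e\<in>?E. if e = mdeg m + s c then Poly_Mapping.lookup (u c) m else 0)"
      by (intro sum.cong) (auto simp: hom_part_def lookup_filter_poly when_def)
    also have "\<dots> = (if mdeg m + s c \<in> ?E then Poly_Mapping.lookup (u c) m else 0)"
      using fin by (rule sum.delta)
    also have "\<dots> = Poly_Mapping.lookup (u c) m"
    proof (cases "m \<in> Poly_Mapping.keys (u c)")
      case True
      moreover from this have "c < n" using assms[of c] by (cases "c < n") auto
      ultimately show ?thesis by auto
    qed (auto simp: in_keys_iff)
    finally show "Poly_Mapping.lookup (u c) m = Poly_Mapping.lookup (\<Sum>e\<in>?E. hom_part s e u c) m"
      by (simp add: lookup_sum)
  qed
qed

lemma module_span_set_iff:
  fixes hs :: "(nat \<Rightarrow> ('v, 'a::field) mpoly) list"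
  shows "u \<in> module_span V (set hs) \<longleftrightarrow>
    (\<exists>w. (\<forall>c<length hs. w c \<in> polys V) \<and> u = (\<lambda>r. \<Sum>c<length hs. (hs ! c) r * w c))"
proof
  assume "u \<in> module_span V (set hs)"
  then show "\<exists>w. (\<forall>c<length hs. w c \<in> polys V) \<and> u = (\<lambda>r. \<Sum>c<length hs. (hs ! c) r * w c)"
  proof induction
    case zero
    show ?case by (intro exI[of _ "\<lambda>c. 0"]) auto
  next
    case (step g k u)
    then obtain w j where w: "\<forall>c<length hs. w c \<in> polys V" "u = (\<lambda>r. \<Sum>c<length hs. (hs ! c) r * w c)"
      and j: "j < length hs" "g = hs ! j" by (auto simp: in_set_conv_nth)
    have "(\<Sum>c<length hs. (hs ! c) r * (w c + (if c = j then k else 0))) = k * g r + u r" for r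
    proof -
      have "(\<Sum>c<length hs. (hs ! c) r * (if c = j then k else 0)) =
          (\<Sum>c<length hs. if c = j then (hs ! c) r * k else 0)" by (intro sum.cong) auto
      also have "\<dots> = k * g r" using j by (simp add: mult.commute)
      finally show ?thesis using w by (simp only: distrib_left sum.distrib add.commute)
    qed
    then show ?case using w step(2) by (intro exI[of _ "\<lambda>c. w c + (if c = j then k else 0)"]) auto
  qed
next
  assume "\<exists>w. (\<forall>c<length hs. w c \<in> polys V) \<and> u = (\<lambda>r. \<Sum>c<length hs. (hs ! c) r * w c)"
  then obtain w where w: "\<forall>c<length hs. w c \<in> polys V" "u = (\<lambda>r. \<Sum>c<length hs. (hs ! c) r * w c)" by blast
  have "(\<lambda>r. w c * (hs ! c) r) \<in> module_span V (set hs)" if "c < length hs" for c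
    using that w by (intro module_span_scale module_span_base) auto
  then have "(\<lambda>r. \<Sum>c<length hs. w c * (hs ! c) r) \<in> module_span V (set hs)"
    by (intro module_span_sum) auto
  then show "u \<in> module_span V (set hs)" using w(2) by (simp add: mult.commute)
qed

text \<open>The last conjunct is an elementary form of Nakayama's lemma: a constant term in a syzygy
  would make one generator redundant. It guarantees that the next matrix, whose columns are
  syzygies, is minimal.\<close>

lemma minimal_homogeneous_generators:
  fixes M :: "(nat \<Rightarrow> ('v::linorder, 'a::field) mpoly) set"
  assumes V: "finite V" and M: "graded_submodule V n s M"
  shows "\<exists>t A. homogeneous_matrix V n s t A \<and> column_span V n (length t) A = M \<and>
    (\<forall>w\<in>syzygies V n (length t) A. \<forall>c. Poly_Mapping.lookup (w c) 0 = 0)"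
proof -
  have fs: "free_submodule V n M" and hp: "\<And>u e. u \<in> M \<Longrightarrow> hom_part s e u \<in> M"
    using M by (auto simp: graded_submodule_def)
  define generates where "generates H \<longleftrightarrow> finite H \<and> H \<subseteq> M \<and> M \<subseteq> module_span V H \<and>
    (\<forall>h\<in>H. \<exists>e. \<forall>c. \<forall>m\<in>Poly_Mapping.keys (h c). mdeg m + s c = e)" for H
  have "\<exists>H. generates H"
  proof -
    obtain G where G: "G \<subseteq> M" "finite G" "M \<subseteq> module_span V G"
      using free_submodule_finitely_generated[OF V fs] by blast
    have "\<forall>g\<in>G. \<exists>E. finite E \<and> g = (\<lambda>c. \<Sum>e\<in>E. hom_part s e g c)"
      using hom_part_decomposition[of n] free_submodule_support[OF fs] G(1) by blast
    then obtain E where E: "\<And>g. g \<in> G \<Longrightarrow> finite (E g)" "\<And>g. g \<in> G \<Longrightarrow> g = (\<lambda>c. \<Sum>e\<in>E g. hom_part s e g c)"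
      by metis
    let ?H = "\<Union>g\<in>G. (\<lambda>e. hom_part s e g) ` E g"
    have "g \<in> module_span V ?H" if "g \<in> G" for g
    proof -
      have "(\<lambda>c. \<Sum>e\<in>E g. hom_part s e g c) \<in> module_span V ?H"
        using that by (intro module_span_sum module_span_base) auto
      then show ?thesis using E(2)[OF that] by simp
    qed
    then have "M \<subseteq> module_span V ?H" using G(3) module_span_trans[of G V ?H] by blast
    moreover have "\<forall>h\<in>?H. \<exists>e. \<forall>c. \<forall>m\<in>Poly_Mapping.keys (h c). mdeg m + s c = e"
      by (auto simp: hom_part_def keys_filter_poly)
    ultimately show ?thesis unfolding generates_def using E(1) G hp by (intro exI[of _ ?H]) auto
  qed
  then obtain H where H: "generates H" and minH: "\<And>H'. generates H' \<Longrightarrow> card H \<le> card H'"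
    using ex_has_least_nat[of generates _ card] by blast
  obtain hs where hs: "set hs = H" "distinct hs"
    using H finite_distinct_list[of H] by (auto simp: generates_def)
  have "\<exists>e. \<forall>c. \<forall>m\<in>Poly_Mapping.keys (h c). mdeg m + s c = e" if "h \<in> H" for h
    using H that by (simp add: generates_def)
  then obtain deg where deg: "\<And>h c m. h \<in> H \<Longrightarrow> m \<in> Poly_Mapping.keys (h c) \<Longrightarrow> mdeg m + s c = deg h"
    by metis
  define t where "t = map deg hs"
  define A where "A r c = (hs ! c) r" for r c
  have hM: "hs ! c \<in> M" if "c < length hs" for c
    using that hs H nth_mem[OF that] by (auto simp: generates_def)
  have hom: "homogeneous_matrix V n s t A"
    using hM deg hs free_submodule_polys[OF fs] by (auto simp: homogeneous_matrix_def t_def A_def)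
  have sup: "(\<Sum>c<length hs. (hs ! c) r * w c) = 0" if "r \<ge> n" for r w
    using hM free_submodule_support[OF fs _ that] by (intro sum.neutral) auto
  then have trunc: "(\<lambda>r. if r < n then \<Sum>c<length hs. (hs ! c) r * w c else 0) =
      (\<lambda>r. \<Sum>c<length hs. (hs ! c) r * w c)" for w by auto
  have "M = module_span V H"
    using H module_span_subset[OF fs] by (auto simp: generates_def)
  then have span: "column_span V n (length t) A = M"
    unfolding hs(1)[symmetric] column_span_def t_def A_def length_map trunc set_eq_iff mem_Collect_eq
      module_span_set_iff by (simp only: conj_commute simp_thms)
  have "Poly_Mapping.lookup (w c) 0 = 0" if w: "w \<in> syzygies V n (length t) A" for w c
  proof (rule ccontr)
    assume nz: "Poly_Mapping.lookup (w c) 0 \<noteq> 0"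
    then have c: "c < length hs" using w by (cases "c < length hs") (auto simp: syzygies_def t_def)
    \<comment> \<open>Only the constant monomial has degree 0, so in the component of degree
      \<open>t ! c\<close> the coordinate \<open>c\<close> shrinks to the scalar
      \<open>\<kappa>\<close>, by which one can divide.\<close>
    define w' where "w' = hom_part (nth t) (t ! c) w"
    have w': "w' \<in> syzygies V n (length t) A"
      using graded_submodule_syzygies[OF hom] w unfolding graded_submodule_def w'_def by blast
    define \<kappa> where "\<kappa> = Poly_Mapping.lookup (w c) 0"
    have w'c: "w' c = Poly_Mapping.single 0 \<kappa>"
      by (rule poly_mapping_eqI)
        (auto simp: w'_def hom_part_def lookup_filter_poly mdeg_eq_0_iff lookup_single when_def \<kappa>_def)
    let ?H' = "H - {hs ! c}"
    have rel: "Poly_Mapping.single 0 \<kappa> * (hs ! c) r + (\<Sum>d\<in>{..<length hs} - {c}. w' d * (hs ! d) r) = 0" for r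
    proof -
      have "(\<Sum>d<length hs. (hs ! d) r * w' d) = 0"
        using w' sup[of r w'] by (cases "r < n") (auto simp: syzygies_def A_def t_def)
      then show ?thesis using c w'c by (simp add: sum.remove[of _ c] mult.commute)
    qed
    have in_span: "(\<lambda>r. \<Sum>d\<in>{..<length hs} - {c}. w' d * (hs ! d) r) \<in> module_span V ?H'"
    proof (intro module_span_sum module_span_scale module_span_base)
      fix d assume "d \<in> {..<length hs} - {c}"
      then show "hs ! d \<in> ?H'" using hs c nth_eq_iff_index_eq[OF hs(2)] by auto
      show "w' d \<in> polys V" using w' \<open>d \<in> _\<close> by (auto simp: syzygies_def t_def)
    qed
    have eq: "(hs ! c) r = Poly_Mapping.single 0 (- 1 / \<kappa>) * (\<Sum>d\<in>{..<length hs} - {c}. w' d * (hs ! d) r)" for r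
    proof -
      have "(\<Sum>d\<in>{..<length hs} - {c}. w' d * (hs ! d) r) = Poly_Mapping.single 0 (- \<kappa>) * (hs ! c) r"
        using rel[of r] by (simp add: single_uminus eq_neg_iff_add_eq_0 add.commute)
      then show ?thesis using nz by (simp add: \<kappa>_def mult_single flip: mult.assoc)
    qed
    have "hs ! c = (\<lambda>r. Poly_Mapping.single 0 (- 1 / \<kappa>) * (\<Sum>d\<in>{..<length hs} - {c}. w' d * (hs ! d) r))"
      using eq by (rule ext)
    also have "\<dots> \<in> module_span V ?H'" using in_span by (intro module_span_scale) auto
    finally have "hs ! c \<in> module_span V ?H'" .
    then have "H \<subseteq> module_span V ?H'" using module_span_base[of _ ?H' V] by blast
    then have "M \<subseteq> module_span V ?H'" using H module_span_trans unfolding generates_def by blast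
    then have "generates ?H'" using H by (auto simp: generates_def)
    moreover have "card ?H' < card H" using H hs c by (intro card_Diff1_less) (auto simp: generates_def)
    ultimately show False using minH[of ?H'] by simp
  qed
  with hom span show ?thesis by blast
qed

section \<open>From matrices and vectors to coefficient functions\<close>

lemma mult_mat_vec_nth:
  assumes "A \<in> carrier_mat n n'" "w \<in> carrier_vec n'" "r < n"
  shows "(A *\<^sub>v w) $ r = (\<Sum>c<n'. A $$ (r, c) * w $ c)"
  using assms by (simp add: scalar_prod_def atLeast0LessThan)

lemma free_module_iff: "w \<in> free_module V n \<longleftrightarrow> (\<exists>u. (\<forall>c<n. u c \<in> polys V) \<and> w = vec n u)"
proof
  assume "w \<in> free_module V n"
  then show "\<exists>u. (\<forall>c<n. u c \<in> polys V) \<and> w = vec n u"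
    by (intro exI[of _ "($) w"]) (auto simp: free_module_def)
qed (auto simp: free_module_def)

lemma mat_kernel_eq_syzygies:
  assumes "A \<in> carrier_mat n n'"
  shows "mat_kernel A \<inter> free_module V n' = vec n' ` syzygies V n n' (\<lambda>r c. A $$ (r, c))" (is "?L = ?R")
proof (intro subset_antisym subsetI)
  fix w assume w: "w \<in> ?L"
  then obtain u where u: "\<forall>c<n'. u c \<in> polys V" "w = vec n' u" by (auto simp: free_module_iff)
  let ?u = "\<lambda>c. if c < n' then u c else 0"
  have "(\<Sum>c<n'. A $$ (r, c) * ?u c) = 0" if "r < n" for r
  proof -
    have "A *\<^sub>v w = 0\<^sub>v n" using w assms by (auto simp: mat_kernel_def)
    then have "(\<Sum>c<n'. A $$ (r, c) * w $ c) = 0"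
      using mult_mat_vec_nth[OF assms _ that, of w] that u by simp
    then show ?thesis using u by simp
  qed
  then have "?u \<in> syzygies V n n' (\<lambda>r c. A $$ (r, c))" using u by (auto simp: syzygies_def)
  moreover have "w = vec n' ?u" using u by auto
  ultimately show "w \<in> ?R" by blast
next
  fix w assume "w \<in> ?R"
  then obtain u where u: "u \<in> syzygies V n n' (\<lambda>r c. A $$ (r, c))" "w = vec n' u" by blast
  have "A *\<^sub>v w = 0\<^sub>v n"
  proof (rule eq_vecI)
    fix r assume "r < dim_vec (0\<^sub>v n :: ('a, 'b) mpoly vec)"
    then show "(A *\<^sub>v w) $ r = 0\<^sub>v n $ r"
      using mult_mat_vec_nth[OF assms, of w r] u by (simp add: syzygies_def)
  qed (use assms in auto)
  moreover have "w \<in> free_module V n'" using u by (auto simp: free_module_iff syzygies_def)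
  ultimately show "w \<in> ?L" using assms u by (auto simp: mat_kernel_def)
qed

lemma mat_image_eq_column_span:
  assumes "A \<in> carrier_mat n n'"
  shows "{A *\<^sub>v w | w. w \<in> free_module V n'} = vec n ` column_span V n n' (\<lambda>r c. A $$ (r, c))" (is "?L = ?R")
proof -
  have eq: "A *\<^sub>v vec n' u = vec n (\<lambda>r. if r < n then \<Sum>c<n'. A $$ (r, c) * u c else 0)" for u
    using assms by (intro eq_vecI) (auto simp: scalar_prod_def atLeast0LessThan)
  have "?L = {A *\<^sub>v vec n' u | u. \<forall>c<n'. u c \<in> polys V}"
    by (auto simp: free_module_iff)
  also have "\<dots> = ?R" unfolding eq column_span_def by auto
  finally show ?thesis .
qed

lemma mat_row_image_eq:
  assumes "A \<in> carrier_mat 1 n'"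
  shows "{(A *\<^sub>v w) $ 0 | w. w \<in> free_module V n'} = {\<Sum>c<n'. A $$ (0, c) * w c | w. \<forall>c<n'. w c \<in> polys V}"
proof -
  have eq: "(A *\<^sub>v vec n' u) $ 0 = (\<Sum>c<n'. A $$ (0, c) * u c)" for u
    using mult_mat_vec_nth[OF assms, of "vec n' u" 0] by simp
  have "{(A *\<^sub>v w) $ 0 | w. w \<in> free_module V n'} = {(A *\<^sub>v vec n' u) $ 0 | u. \<forall>c<n'. u c \<in> polys V}"
    by (auto simp: free_module_iff)
  then show ?thesis unfolding eq .
qed

lemma vec_image_eq_iff:
  assumes "\<And>u c. u \<in> X \<union> Y \<Longrightarrow> c \<ge> n \<Longrightarrow> u c = 0"
  shows "vec n ` X = vec n ` Y \<longleftrightarrow> X = Y"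
proof (rule inj_on_image_eq_iff)
  show "inj_on (vec n) (X \<union> Y)"
  proof (rule inj_onI, rule ext)
    fix u v c assume uv: "u \<in> X \<union> Y" "v \<in> X \<union> Y" "vec n u = vec n v"
    have "vec n u $ c = vec n v $ c" using uv(3) by simp
    then show "u c = v c" using assms[of u c] assms[of v c] uv(1,2) by (cases "c < n") (auto simp: not_less)
  qed
qed auto

text \<open>The bridge between the matrices of the statement and the coefficient functions, in which
  both the existence proof and the Koszul comparison are carried out.\<close>

lemma graded_free_resolution_iff:
  fixes F :: "('v, 'a::field) mpoly free_complex"
  defines "rk \<equiv> \<lambda>i. length (shifts F i)"
    and "a \<equiv> \<lambda>i r c. boundary F i $$ (r, c)"
  assumes maps: "graded_free_maps V F" and s0: "shifts F 0 = [0]"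
  shows "graded_free_resolution V J F \<longleftrightarrow>
    {\<Sum>c<rk 1. a 0 0 c * w c | w. \<forall>c<rk 1. w c \<in> polys V} = J \<and>
    (\<forall>i. syzygies V (rk i) (rk (Suc i)) (a i) = column_span V (rk (Suc i)) (rk (Suc (Suc i))) (a (Suc i)))"
proof -
  have cm: "boundary F i \<in> carrier_mat (rk i) (rk (Suc i))" for i
    using maps by (simp add: graded_free_maps_def rk_def)
  then have "boundary F 0 \<in> carrier_mat 1 (rk 1)" using s0 by (metis One_nat_def length_Cons list.size(3) rk_def)
  note row = mat_row_image_eq[OF this, of V]
  have "syzygies V (rk i) (rk (Suc i)) (a i) = column_span V (rk (Suc i)) (rk (Suc (Suc i))) (a (Suc i)) \<longleftrightarrow>
      mat_kernel (boundary F i) \<inter> free_module V (rk (Suc i)) =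
      {boundary F (Suc i) *\<^sub>v w | w. w \<in> free_module V (rk (Suc (Suc i)))}" for i
    unfolding mat_kernel_eq_syzygies[OF cm] mat_image_eq_column_span[OF cm] a_def
    by (rule vec_image_eq_iff[symmetric]) (auto simp: syzygies_def column_span_def)
  with row show ?thesis
    using maps s0 by (simp add: graded_free_resolution_def rk_def a_def)
qed

lemma column_in_column_span:
  assumes "c < n'"
  shows "(\<lambda>r. if r < n then A r c else 0) \<in> column_span V n n' A"
proof -
  have "(\<Sum>d<n'. A r d * (if d = c then 1 else 0)) = A r c" for r
    using assms by (simp add: if_distrib sum.delta cong: if_cong)
  then show ?thesis unfolding column_span_def
    by (intro CollectI exI[of _ "\<lambda>d. if d = c then 1 else 0"]) auto
qed

theorem minimal_graded_free_resolution_exists: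
  fixes J :: "('v::linorder, 'a::field) mpoly set"
  assumes V: "finite V"
    and J: "graded_submodule V 1 (\<lambda>_. 0) ((\<lambda>p r. if r = 0 then p else 0) ` J)"
    and proper: "\<And>p. p \<in> J \<Longrightarrow> Poly_Mapping.lookup p 0 = 0"
  shows "\<exists>F. minimal_graded_free_resolution V J F"
proof -
  let ?M = "(\<lambda>p r. if r = 0 then p else 0) ` J :: (nat \<Rightarrow> ('v, 'a) mpoly) set"
  \<comment> \<open>One boundary map is chosen at a time. A state holds the row degrees
    \<open>s\<close>, the column degrees \<open>t\<close> and the matrix \<open>A\<close>. The
    condition on syzygies is carried along because it makes the next matrix free of constant terms;
    for the first matrix this comes from \<open>proper\<close>.\<close>
  define P where "P i x = (case x of (s, t, A) \<Rightarrow>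
      homogeneous_matrix V (length s) (nth s) t A \<and>
      (\<forall>u\<in>syzygies V (length s) (length t) A. \<forall>c. Poly_Mapping.lookup (u c) 0 = 0) \<and>
      (\<forall>r<length s. \<forall>c<length t. Poly_Mapping.lookup (A r c) 0 = 0) \<and>
      (i = 0 \<longrightarrow> s = [0] \<and> column_span V 1 (length t) A = ?M))"
    for i :: nat and x :: "nat list \<times> nat list \<times> (nat \<Rightarrow> nat \<Rightarrow> ('v, 'a) mpoly)"
  define Q where "Q x y = (case x of (s, t, A) \<Rightarrow> case y of (s', t', A') \<Rightarrow>
      s' = t \<and> column_span V (length s') (length t') A' = syzygies V (length s) (length t) A)"
    for x y :: "nat list \<times> nat list \<times> (nat \<Rightarrow> nat \<Rightarrow> ('v, 'a) mpoly)"
  have no_consts: "Poly_Mapping.lookup (A r c) 0 = 0"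
    if "r < n" "c < n'" "\<And>u c. u \<in> column_span V n n' A \<Longrightarrow> Poly_Mapping.lookup (u c) 0 = 0"
    for A :: "nat \<Rightarrow> nat \<Rightarrow> ('v, 'a) mpoly" and n n' r c
    using that(3)[OF column_in_column_span[OF that(2)], of r] that(1) by simp
  have "\<exists>f. \<forall>i. P i (f i) \<and> Q (f i) (f (Suc i))"
  proof (rule dependent_nat_choice)
    obtain t A where tA: "homogeneous_matrix V 1 (\<lambda>_. 0) t A" "column_span V 1 (length t) A = ?M"
      "\<forall>w\<in>syzygies V 1 (length t) A. \<forall>c. Poly_Mapping.lookup (w c) 0 = 0"
      using minimal_homogeneous_generators[OF V J] by blast
    have "Poly_Mapping.lookup (A 0 c) 0 = 0" if "c < length t" for c
      by (rule no_consts[of 0 1 c "length t"]) (use that tA(2) proper in auto)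
    then show "\<exists>x. P 0 x" using tA by (intro exI[of _ "([0], t, A)"]) (auto simp: P_def homogeneous_matrix_def)
  next
    fix x i assume x: "P i x"
    obtain s t A where [simp]: "x = (s, t, A)" by (cases x) auto
    let ?K = "syzygies V (length s) (length t) A"
    have hom: "homogeneous_matrix V (length s) (nth s) t A" using x by (simp add: P_def)
    obtain t' A' where tA: "homogeneous_matrix V (length t) (nth t) t' A'"
      "column_span V (length t) (length t') A' = ?K"
      "\<forall>w\<in>syzygies V (length t) (length t') A'. \<forall>c. Poly_Mapping.lookup (w c) 0 = 0"
      using minimal_homogeneous_generators[OF V graded_submodule_syzygies[OF hom]] by blast
    have "Poly_Mapping.lookup (A' r c) 0 = 0" if "r < length t" "c < length t'" for r c
      by (rule no_consts[OF that]) (use tA(2) x in \<open>auto simp: P_def\<close>)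
    then show "\<exists>y. P (Suc i) y \<and> Q x y" using tA by (intro exI[of _ "(t, t', A')"]) (auto simp: P_def Q_def)
  qed
  then obtain f where f: "\<And>i. P i (f i)" "\<And>i. Q (f i) (f (Suc i))" by blast
  define S where "S i = fst (f i)" for i
  define B where "B i = snd (snd (f i))" for i
  have fS: "f i = (S i, S (Suc i), B i)" for i
    using f(2)[of i] by (auto simp: Q_def S_def B_def split: prod.splits)
  have hom: "homogeneous_matrix V (length (S i)) (nth (S i)) (S (Suc i)) (B i)"
    and min: "\<And>r c. r < length (S i) \<Longrightarrow> c < length (S (Suc i)) \<Longrightarrow> Poly_Mapping.lookup (B i r c) 0 = 0"
    and exact: "column_span V (length (S (Suc i))) (length (S (Suc (Suc i)))) (B (Suc i)) =
      syzygies V (length (S i)) (length (S (Suc i))) (B i)" for i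
    using f[of i] fS[of i] fS[of "Suc i"] by (auto simp: P_def Q_def)
  have S0: "S 0 = [0]" and span0: "column_span V 1 (length (S 1)) (B 0) = ?M"
    using f(1)[of 0] fS[of 0] by (auto simp: P_def)
  define F where "F = \<lparr>shifts = S, boundary = \<lambda>i. mat (length (S i)) (length (S (Suc i))) (\<lambda>(r, c). B i r c)\<rparr>"
  have shifts: "shifts F = S" by (simp add: F_def)
  have entry: "boundary F i $$ (r, c) = B i r c" if "r < length (S i)" "c < length (S (Suc i))" for i r c
    using that by (simp add: F_def)
  have maps: "graded_free_maps V F"
    using hom by (auto simp: graded_free_maps_def F_def homogeneous_matrix_def)
  have "graded_free_resolution V J F"
    unfolding graded_free_resolution_iff[OF maps, unfolded shifts, OF S0]
  proof (intro conjI allI)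
    have "{\<Sum>c<length (S 1). boundary F 0 $$ (0, c) * w c | w. \<forall>c<length (S 1). w c \<in> polys V} =
        (\<lambda>u. u 0) ` column_span V 1 (length (S 1)) (B 0)"
      unfolding column_span_def setcompr_eq_image image_image using entry[of 0 0] S0 by simp
    also have "\<dots> = J" unfolding span0 by (simp add: image_image)
    finally show "{\<Sum>c<length (S 1). boundary F 0 $$ (0, c) * w c | w. \<forall>c<length (S 1). w c \<in> polys V} = J" .
    fix i
    have "syzygies V (length (S i)) (length (S (Suc i))) (\<lambda>r c. boundary F i $$ (r, c)) =
        syzygies V (length (S i)) (length (S (Suc i))) (B i)"
      unfolding syzygies_def using entry by (auto intro!: sum.cong)
    moreover have "column_span V (length (S (Suc i))) (length (S (Suc (Suc i)))) (\<lambda>r c. boundary F (Suc i) $$ (r, c)) =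
        column_span V (length (S (Suc i))) (length (S (Suc (Suc i)))) (B (Suc i))"
      unfolding column_span_def using entry[of _ "Suc i"] by (simp cong: if_cong)
    ultimately show "syzygies V (length (S i)) (length (S (Suc i))) (\<lambda>r c. boundary F i $$ (r, c)) =
        column_span V (length (S (Suc i))) (length (S (Suc (Suc i)))) (\<lambda>r c. boundary F (Suc i) $$ (r, c))"
      using exact by simp
  qed
  then have "minimal_graded_free_resolution V J F"
    using min entry by (simp add: minimal_graded_free_resolution_def shifts)
  then show ?thesis by blast
qed

lemma minimal_graded_free_resolution_complex:
  fixes F :: "('v, 'a::field) mpoly free_complex"
  assumes F: "minimal_graded_free_resolution (set xs) J F" and xs: "distinct xs"
  defines "rk \<equiv> \<lambda>i. length (shifts F i)"
    and "a \<equiv> \<lambda>i r c. boundary F i $$ (r, c)"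
  shows "minimal_exact_complex xs rk a" "minimal_exact_complex.augmentation_ideal xs rk a = J" "rk 0 = 1"
proof -
  have res: "graded_free_resolution (set xs) J F" and maps: "graded_free_maps (set xs) F" and s0: "shifts F 0 = [0]"
    using F by (auto simp: minimal_graded_free_resolution_def graded_free_resolution_def)
  have iff: "graded_free_resolution (set xs) J F \<longleftrightarrow>
    {\<Sum>c<rk 1. a 0 0 c * w c | w. \<forall>c<rk 1. w c \<in> polys (set xs)} = J \<and>
    (\<forall>i. syzygies (set xs) (rk i) (rk (Suc i)) (a i) =
      column_span (set xs) (rk (Suc i)) (rk (Suc (Suc i))) (a (Suc i)))"
    unfolding rk_def a_def by (rule graded_free_resolution_iff[OF maps s0])
  have ker: "syzygies (set xs) (rk i) (rk (Suc i)) (a i) =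
      column_span (set xs) (rk (Suc i)) (rk (Suc (Suc i))) (a (Suc i))" for i
    using res iff by blast
  show complex: "minimal_exact_complex xs rk a"
  proof
    show "a i r c \<in> polys (set xs)" if "r < rk i" "c < rk (Suc i)" for i r c
      using maps that by (auto simp: graded_free_maps_def rk_def a_def)
    show "Poly_Mapping.lookup (a i r c) 0 = 0" if "r < rk i" "c < rk (Suc i)" for i r c
      using F that by (auto simp: minimal_graded_free_resolution_def rk_def a_def)
  next
    fix i and u :: "nat \<Rightarrow> ('v, 'a) mpoly" assume u: "\<And>c. c < rk (Suc i) \<Longrightarrow> u c \<in> polys (set xs)"
    let ?u = "\<lambda>c. if c < rk (Suc i) then u c else 0"
    have "(\<forall>r<rk i. (\<Sum>c<rk (Suc i). a i r c * u c) = 0) \<longleftrightarrow>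
        ?u \<in> syzygies (set xs) (rk i) (rk (Suc i)) (a i)"
      using u by (simp add: syzygies_def)
    also have "\<dots> \<longleftrightarrow> (\<exists>w. (\<forall>d<rk (Suc (Suc i)). w d \<in> polys (set xs)) \<and>
        (\<forall>c<rk (Suc i). u c = (\<Sum>d<rk (Suc (Suc i)). a (Suc i) c d * w d)))"
      unfolding ker column_span_def by (auto simp: fun_eq_iff)
    finally show "(\<forall>r<rk i. (\<Sum>c<rk (Suc i). a i r c * u c) = 0) \<longleftrightarrow>
        (\<exists>w. (\<forall>d<rk (Suc (Suc i)). w d \<in> polys (set xs)) \<and>
        (\<forall>c<rk (Suc i). u c = (\<Sum>d<rk (Suc (Suc i)). a (Suc i) c d * w d)))" .
  qed (rule xs)
  show "minimal_exact_complex.augmentation_ideal xs rk a = J"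
    using res iff by (simp add: minimal_exact_complex.augmentation_ideal_def[OF complex])
  show "rk 0 = 1" using s0 by (simp add: rk_def)
qed

section \<open>Monomial ideals\<close>

lemma ideal_poly_ringI:
  fixes I :: "('v, 'a::field) mpoly set"
  assumes "I \<subseteq> polys V" "0 \<in> I" "\<And>p q. p \<in> I \<Longrightarrow> q \<in> I \<Longrightarrow> p + q \<in> I"
    and "\<And>p q. p \<in> I \<Longrightarrow> q \<in> polys V \<Longrightarrow> q * p \<in> I"
  shows "ideal I (poly_ring V)"
proof -
  interpret cring "poly_ring V :: ('v, 'a) mpoly ring" by (rule cring_poly_ring)
  have uminus: "- p \<in> I" if "p \<in> I" for p
    using assms(4)[OF that, of "- 1"] by (simp add: polys_uminus)
  have inv: "inv\<^bsub>add_monoid (poly_ring V)\<^esub> p = - p" if "p \<in> I" for p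
    using minus_equality[of "- p" p] that uminus assms(1)
    by (auto simp: a_inv_def poly_ring_def polys_def)
  show ?thesis
  proof (rule idealI)
    show "ring (poly_ring V :: ('v, 'a) mpoly ring)" by unfold_locales
    show "subgroup I (add_monoid (poly_ring V))"
      using assms(1-3) inv uminus by (auto simp: subgroup_def poly_ring_def polys_def)
  qed (use assms(4) in \<open>auto simp: poly_ring_def polys_def mult.commute\<close>)
qed

lemma ideal_by_monomials:
  assumes "\<And>m d. P m \<Longrightarrow> P (m + d)"
  shows "ideal {p \<in> polys V. \<forall>m\<in>Poly_Mapping.keys p. P m} (poly_ring V :: ('v, 'a::field) mpoly ring)"
proof (rule ideal_poly_ringI)
  fix p q :: "('v, 'a) mpoly"
  assume p: "p \<in> {p \<in> polys V. \<forall>m\<in>Poly_Mapping.keys p. P m}"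
  { assume "q \<in> {p \<in> polys V. \<forall>m\<in>Poly_Mapping.keys p. P m}"
    then show "p + q \<in> {p \<in> polys V. \<forall>m\<in>Poly_Mapping.keys p. P m}"
      using p Poly_Mapping.keys_add[of p q] by auto }
  assume "q \<in> polys V"
  then show "q * p \<in> {p \<in> polys V. \<forall>m\<in>Poly_Mapping.keys p. P m}"
    using p assms keys_mult[of p q] by (auto simp: mult.commute[of q])
qed auto

lemma genideal_monomials:
  assumes "\<And>u. u \<in> E \<Longrightarrow> Poly_Mapping.keys u \<subseteq> V"
  shows "genideal (poly_ring V :: ('v, 'a::field) mpoly ring) {Poly_Mapping.single u 1 | u. u \<in> E} =
    {p \<in> polys V. \<forall>m\<in>Poly_Mapping.keys p. \<exists>u\<in>E. \<exists>d. m = u + d}" (is "?J = ?N")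
proof
  interpret cring "poly_ring V :: ('v, 'a) mpoly ring" by (rule cring_poly_ring)
  let ?G = "{Poly_Mapping.single u 1 | u. u \<in> E} :: ('v, 'a) mpoly set"
  have G: "?G \<subseteq> carrier (poly_ring V)" using assms by auto
  interpret J: ideal ?J "poly_ring V" by (rule genideal_ideal[OF G])
  have "ideal ?N (poly_ring V)"
    by (rule ideal_by_monomials[where P = "\<lambda>m. \<exists>u\<in>E. \<exists>d. m = u + d"]) (metis add.assoc)
  then show "?J \<subseteq> ?N"
  proof (rule genideal_minimal)
    have "\<exists>u'\<in>E. \<exists>d. u = u' + d" if "u \<in> E" for u
      using that by (intro bexI[of _ u] exI[of _ 0]) auto
    then show "?G \<subseteq> ?N" using G by auto
  qed
  show "?N \<subseteq> ?J"
  proof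
    fix p assume p: "p \<in> ?N"
    have "Poly_Mapping.single m (Poly_Mapping.lookup p m) \<in> ?J" if m: "m \<in> Poly_Mapping.keys p" for m
    proof -
      obtain u d where u: "u \<in> E" "m = u + d" using p m by blast
      have "Poly_Mapping.keys m \<subseteq> V" using p m by (auto simp: polys_iff)
      then have "Poly_Mapping.single d (Poly_Mapping.lookup p m) \<in> carrier (poly_ring V)"
        using u by (auto simp: keys_monomial_add)
      moreover have "Poly_Mapping.single u 1 \<in> ?J" using genideal_self[OF G] u by blast
      ultimately have "Poly_Mapping.single d (Poly_Mapping.lookup p m) \<otimes>\<^bsub>poly_ring V\<^esub> Poly_Mapping.single u 1 \<in> ?J"
        by (intro J.I_l_closed)
      then show ?thesis using u by (simp add: poly_ring_def mult_single add.commute)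
    qed
    moreover have "sum f A \<in> ?J" if "finite A" "\<And>i. i \<in> A \<Longrightarrow> f i \<in> ?J" for A :: "'v monomial set" and f
      using that
    proof (induction A)
      case empty
      show ?case using J.zero_closed by (simp add: poly_ring_def)
    next
      case (insert i A)
      then show ?case using J.a_closed[of "f i" "sum f A"] by (simp add: poly_ring_def)
    qed
    ultimately have "(\<Sum>m\<in>Poly_Mapping.keys p. Poly_Mapping.single m (Poly_Mapping.lookup p m)) \<in> ?J"
      by simp
    then show "p \<in> ?J" by (simp add: poly_as_sum_of_singles)
  qed
qed

lemma graded_submodule_monomial_ideal:
  assumes J: "J = {p \<in> polys V. \<forall>m\<in>Poly_Mapping.keys p. P m}" and P: "\<And>m d. P m \<Longrightarrow> P (m + d)"
  shows "graded_submodule V 1 (\<lambda>_. 0) ((\<lambda>p r. if r = 0 then p else 0) ` (J :: ('v, 'a::field) mpoly set))"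
    (is "graded_submodule V 1 ?s (?f ` J)")
proof -
  interpret cring "poly_ring V :: ('v, 'a) mpoly ring" by (rule cring_poly_ring)
  interpret J: ideal J "poly_ring V :: ('v, 'a) mpoly ring" unfolding J by (rule ideal_by_monomials[where P = P]) (rule P)
  have J_zero: "0 \<in> J" and J_add: "p \<in> J \<Longrightarrow> q \<in> J \<Longrightarrow> p + q \<in> J"
    and J_scale: "k \<in> polys V \<Longrightarrow> p \<in> J \<Longrightarrow> k * p \<in> J" for p q k
    using J.zero_closed J.a_closed[of p q] J.I_l_closed[of p k] by (auto simp: poly_ring_def polys_def)
  have "free_submodule V 1 (?f ` J)"
    unfolding free_submodule_def
  proof (intro conjI ballI allI impI)
    fix u c assume "u \<in> ?f ` J"
    then obtain p where p: "p \<in> J" "u = ?f p" by (rule imageE)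
    then show "u c \<in> polys V" using J by simp
    show "u c = 0" if "c \<ge> 1" using p that by simp
  next
    have "(\<lambda>c. 0) = ?f 0" by (simp add: fun_eq_iff)
    then show "(\<lambda>c. 0) \<in> ?f ` J" using J_zero by (rule image_eqI)
  next
    fix u v assume "u \<in> ?f ` J" "v \<in> ?f ` J"
    then obtain p q where pq: "p \<in> J" "u = ?f p" "q \<in> J" "v = ?f q" by (elim imageE) (rule that)
    then have "(\<lambda>c. u c + v c) = ?f (p + q)" by (simp add: fun_eq_iff)
    then show "(\<lambda>c. u c + v c) \<in> ?f ` J" using J_add[OF pq(1,3)] by (rule image_eqI)
  next
    fix k :: "('v, 'a) mpoly" and u assume k: "k \<in> polys V" and "u \<in> ?f ` J"
    then obtain p where p: "p \<in> J" "u = ?f p" by (elim imageE) (rule that)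
    then have "(\<lambda>c. k * u c) = ?f (k * p)" by (simp add: fun_eq_iff)
    then show "(\<lambda>c. k * u c) \<in> ?f ` J" using J_scale[OF k p(1)] by (rule image_eqI)
  qed
  moreover have "hom_part ?s e u \<in> ?f ` J" if u: "u \<in> ?f ` J" for u e
  proof -
    from u obtain p where p: "p \<in> J" "u = ?f p" by (rule imageE)
    then have "hom_part ?s e u = ?f (filter_poly (\<lambda>m. mdeg m = e) p)"
      by (simp add: hom_part_def fun_eq_iff)
    moreover have "filter_poly (\<lambda>m. mdeg m = e) p \<in> J"
      using p(1) filter_poly_in_polys[of p V] unfolding J by (simp add: keys_filter_poly)
    ultimately show ?thesis by (rule image_eqI)
  qed
  ultimately show ?thesis unfolding graded_submodule_def by blast
qed

section \<open>The initial ideal of the Crystal lattice\<close>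

text \<open>Leading monomials in the finite generation argument are taken with respect to a linear
  order on the type of variables; \<open>crystal_var_less\<close> provides it.\<close>

instantiation crystal_elt :: linorder
begin

definition less_eq_crystal_elt :: "crystal_elt \<Rightarrow> crystal_elt \<Rightarrow> bool" where
  "less_eq_crystal_elt x y \<longleftrightarrow> x = y \<or> crystal_var_less x y"

definition less_crystal_elt :: "crystal_elt \<Rightarrow> crystal_elt \<Rightarrow> bool" where
  "less_crystal_elt x y \<longleftrightarrow> crystal_var_less x y"

instance
proof
  fix x y z :: crystal_elt
  show "x < y \<longleftrightarrow> x \<le> y \<and> \<not> y \<le> x"
    unfolding less_eq_crystal_elt_def less_crystal_elt_def by (cases x; cases y) auto
  show "x \<le> y \<Longrightarrow> y \<le> z \<Longrightarrow> x \<le> z"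
    unfolding less_eq_crystal_elt_def by (cases x; cases y; cases z) auto
  show "x \<le> y \<Longrightarrow> y \<le> x \<Longrightarrow> x = y"
    unfolding less_eq_crystal_elt_def by (cases x; cases y) auto
  show "x \<le> y \<or> y \<le> x"
    unfolding less_eq_crystal_elt_def by (cases x; cases y) auto
qed (simp add: less_eq_crystal_elt_def)

end

lemma binomial_keys:
  assumes "u \<noteq> v"
  shows "Poly_Mapping.keys (Poly_Mapping.single u 1 - Poly_Mapping.single v (1::'a::field)) = {u, v}"
  using assms by (auto simp: in_keys_iff lookup_minus lookup_single when_def split: if_splits)

lemma var_mult: "var x * var y = Poly_Mapping.single (Poly_Mapping.single x 1 + Poly_Mapping.single y 1) 1"
  by (simp add: var_def mult_single)

text \<open>Each generator involves only two quadratic monomials, and the polynomials all of whose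
  monomials have degree at least 2 form an ideal.\<close>

lemma join_meet_ideal_degree:
  fixes L :: "('v, 'm) gorder_scheme"
  assumes "lattice L" "p \<in> (join_meet_ideal L :: ('v, 'a::field) mpoly set)"
  shows "p \<in> polys (carrier L)" "m \<in> Poly_Mapping.keys p \<Longrightarrow> mdeg m \<ge> 2"
proof -
  interpret lattice L by fact
  interpret cring "poly_ring (carrier L) :: ('v, 'a) mpoly ring" by (rule cring_poly_ring)
  let ?N = "{p \<in> polys (carrier L). \<forall>m\<in>Poly_Mapping.keys p. mdeg m \<ge> 2} :: ('v, 'a) mpoly set"
  have "join_meet_ideal L \<subseteq> ?N"
    unfolding join_meet_ideal_def
  proof (rule genideal_minimal)
    show "ideal ?N (poly_ring (carrier L))" by (rule ideal_by_monomials) (simp add: mdeg_add)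
    show "{var a * var b - var (a \<squnion>\<^bsub>L\<^esub> b) * var (a \<sqinter>\<^bsub>L\<^esub> b) | a b. a \<in> carrier L \<and> b \<in> carrier L} \<subseteq> ?N"
    proof
      fix q :: "('v, 'a) mpoly"
      assume "q \<in> {var a * var b - var (a \<squnion>\<^bsub>L\<^esub> b) * var (a \<sqinter>\<^bsub>L\<^esub> b) | a b. a \<in> carrier L \<and> b \<in> carrier L}"
      then obtain a b where q: "q = var a * var b - var (a \<squnion>\<^bsub>L\<^esub> b) * var (a \<sqinter>\<^bsub>L\<^esub> b)"
        and ab: "a \<in> carrier L" "b \<in> carrier L" by blast
      have "Poly_Mapping.keys q \<subseteq> {Poly_Mapping.single a 1 + Poly_Mapping.single b 1,
          Poly_Mapping.single (a \<squnion>\<^bsub>L\<^esub> b) 1 + Poly_Mapping.single (a \<sqinter>\<^bsub>L\<^esub> b) 1}"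
        unfolding q var_mult using keys_diff by fastforce
      moreover have "q \<in> polys (carrier L)" unfolding q
        by (intro polys_diff polys_mult polys_var ab join_closed meet_closed)
      ultimately show "q \<in> ?N" by (auto simp: mdeg_add mdeg_single)
    qed
  qed
  then show "p \<in> polys (carrier L)" "m \<in> Poly_Mapping.keys p \<Longrightarrow> mdeg m \<ge> 2" using assms(2) by auto
qed

text \<open>The property \<open>P\<close> of a monomial is divisibility by the initial monomial of
  some element of the join-meet ideal. These initial monomials are never determined: a degree bound
  for all of them and the explicit products of incomparable elements suffice.\<close>

lemma crystal_initial_ideal:
  fixes k :: nat and n :: "nat \<Rightarrow> nat"
  defines "L \<equiv> crystal_lattice k n"
  defines "J \<equiv> initial_ideal (carrier L) (revlex_less crystal_var_less) (join_meet_ideal L)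
    :: (crystal_elt, 'a::field) mpoly set"
  shows "\<exists>P. J = {p \<in> polys (carrier L). \<forall>m\<in>Poly_Mapping.keys p. P m} \<and> (\<forall>m d. P m \<longrightarrow> P (m + d)) \<and>
      (\<forall>m. P m \<longrightarrow> mdeg m \<ge> 2)" (is ?monomial)
    and "Cx i r \<in> carrier L \<Longrightarrow> Cx j q \<in> carrier L \<Longrightarrow> i \<noteq> j \<Longrightarrow> var (Cx i r) * var (Cx j q) \<in> J"
proof -
  let ?I = "join_meet_ideal L :: (crystal_elt, 'a) mpoly set" and ?prec = "revlex_less crystal_var_less"
  define E where "E = {u. \<exists>p\<in>?I. p \<noteq> 0 \<and> is_initial_monomial ?prec p u}"
  have lat: "lattice L" unfolding L_def by (rule lattice_crystal_lattice)
  have E: "Poly_Mapping.keys u \<subseteq> carrier L" "mdeg u \<ge> 2" if "u \<in> E" for u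
  proof -
    from \<open>u \<in> E\<close> obtain p where p: "p \<in> ?I" "u \<in> Poly_Mapping.keys p"
      by (auto simp: E_def is_initial_monomial_def)
    show "Poly_Mapping.keys u \<subseteq> carrier L"
      using join_meet_ideal_degree(1)[OF lat p(1)] p(2) by (simp add: polys_iff)
    show "mdeg u \<ge> 2" using join_meet_ideal_degree(2)[OF lat p] .
  qed
  have J: "J = {p \<in> polys (carrier L). \<forall>m\<in>Poly_Mapping.keys p. \<exists>u\<in>E. \<exists>d. m = u + d}"
  proof -
    have "J = genideal (poly_ring (carrier L)) {Poly_Mapping.single u 1 | u. u \<in> E}"
      unfolding J_def initial_ideal_def E_def by simp
    also have "\<dots> = {p \<in> polys (carrier L). \<forall>m\<in>Poly_Mapping.keys p. \<exists>u\<in>E. \<exists>d. m = u + d}"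
      by (rule genideal_monomials) (rule E(1))
    finally show ?thesis .
  qed
  moreover have "\<exists>u'\<in>E. \<exists>d''. u + d + d' = u' + d''" "mdeg (u + d) \<ge> 2" if "u \<in> E" for u d d'
    using that E(2)[of u] by (auto simp: add.assoc mdeg_add)
  ultimately show ?monomial
    by (intro exI[of _ "\<lambda>m. \<exists>u\<in>E. \<exists>d. m = u + d"]) blast
  assume x: "Cx i r \<in> carrier L" "Cx j q \<in> carrier L" "i \<noteq> j"
  let ?u = "Poly_Mapping.single (Cx i r) 1 + Poly_Mapping.single (Cx j q) 1 :: crystal_elt monomial"
  let ?v = "Poly_Mapping.single Ct 1 + Poly_Mapping.single Cs 1 :: crystal_elt monomial"
  let ?p = "Poly_Mapping.single ?u 1 - Poly_Mapping.single ?v 1 :: (crystal_elt, 'a) mpoly"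
  have "Poly_Mapping.lookup ?u Cs = 0" "Poly_Mapping.lookup ?v Cs = 1"
    by (auto simp: lookup_add lookup_single)
  then have uv: "?u \<noteq> ?v" by auto
  interpret L: lattice L by (rule lat)
  interpret cring "poly_ring (carrier L) :: (crystal_elt, 'a) mpoly ring" by (rule cring_poly_ring)
  have "?p = var (Cx i r) * var (Cx j q) - var (Cx i r \<squnion>\<^bsub>L\<^esub> Cx j q) * var (Cx i r \<sqinter>\<^bsub>L\<^esub> Cx j q)"
    using x crystal_join_meet[of i r k n j q] unfolding var_mult by (simp add: L_def)
  moreover have "\<dots> \<in> ?I"
    unfolding join_meet_ideal_def
  proof (rule subsetD[OF genideal_self])
    show "{var a * var b - var (a \<squnion>\<^bsub>L\<^esub> b) * var (a \<sqinter>\<^bsub>L\<^esub> b) | a b. a \<in> carrier L \<and> b \<in> carrier L}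
      \<subseteq> carrier (poly_ring (carrier L))"
      by (auto intro!: polys_diff polys_mult polys_var)
  qed (use x in blast)
  moreover have "is_initial_monomial ?prec ?p ?u"
  proof -
    \<comment> \<open>\<open>Cs\<close> is the smallest variable and occurs in \<open>?v\<close>
      only, so the reverse lexicographic order places \<open>?v\<close> below
      \<open>?u\<close>.\<close>
    have "\<not> crystal_var_less y Cs" for y by (cases y) auto
    then have "?prec ?v ?u"
      unfolding revlex_less_def
      by (intro disjI2 conjI exI[of _ Cs] allI impI) (auto simp: mdeg_add mdeg_single lookup_add lookup_single)
    then show ?thesis unfolding is_initial_monomial_def binomial_keys[OF uv] by simp
  qed
  moreover have "?p \<noteq> 0" using binomial_keys[OF uv, where 'a = 'a] by auto
  ultimately have "?u \<in> E" unfolding E_def by (metis (mono_tags, lifting) mem_Collect_eq)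
  then show "var (Cx i r) * var (Cx j q) \<in> J"
    using E(1)[of ?u] unfolding J var_mult by (auto intro!: bexI[of _ ?u] exI[of _ 0])
qed

text \<open>The summand 2 accounts for \<open>Cs\<close> and \<open>Ct\<close>; it becomes the 2 in
  the upper bound on the projective dimension.\<close>

lemma crystal_carrier:
  "finite (carrier (crystal_lattice k n))"
  "card (carrier (crystal_lattice k n)) \<le> (\<Sum>i = 1..k. n i) + 2"
proof -
  let ?S = "SIGMA i:{1..k}. {1..n i}"
  have eq: "carrier (crystal_lattice k n) = {Cs, Ct} \<union> case_prod Cx ` ?S"
    by (auto simp: crystal_lattice_def image_iff)
  show "finite (carrier (crystal_lattice k n))" unfolding eq by simp
  have "card (carrier (crystal_lattice k n)) \<le> card {Cs, Ct} + card (case_prod Cx ` ?S)"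
    unfolding eq by (rule card_Un_le)
  also have "\<dots> \<le> 2 + card ?S" by (intro add_mono card_image_le) auto
  finally show "card (carrier (crystal_lattice k n)) \<le> (\<Sum>i = 1..k. n i) + 2" by simp
qed

text \<open>Degrees that are not shifts contribute 0, so the series is a finite sum of
  multiplicities in a list.\<close>

lemma suminf_graded_betti: "suminf (graded_betti V J i) = length (shifts (the_resolution V J) i)"
proof -
  let ?s = "shifts (the_resolution V J) i"
  have "suminf (graded_betti V J i) = sum (graded_betti V J i) (set ?s)"
    by (intro suminf_finite) (auto simp: graded_betti_def count_list_0_iff)
  then show ?thesis by (simp add: graded_betti_def sum_count_set)
qed

theorem corollary1p3:
  fixes k :: nat and n :: "nat \<Rightarrow> nat"
    and L :: "crystal_elt gorder"
    and I J :: "(crystal_elt, 'a::field) mpoly set"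
  assumes "k > 2"
    and "\<And>i. i \<in> {1..k} \<Longrightarrow> n i > 0"
    and "L = crystal_lattice k n"
    and "I = join_meet_ideal L"
    and "J = initial_ideal (carrier L) (revlex_less crystal_var_less) I"
  shows "enat (Max (n ` {1..k})) \<le> proj_dim (carrier L) J \<and>
    proj_dim (carrier L) J \<le> enat ((\<Sum>i = 1..k. n i) + 2) \<and>
    (\<forall>i\<in>{1..n 1}. n 1 choose i \<le> suminf (graded_betti (carrier L) J i))"
proof -
  let ?V = "carrier L"
  obtain P where P: "J = {p \<in> polys ?V. \<forall>m\<in>Poly_Mapping.keys p. P m}"
    "\<And>m d. P m \<Longrightarrow> P (m + d)" "\<And>m. P m \<Longrightarrow> mdeg m \<ge> 2"
    using crystal_initial_ideal(1)[of k n, where 'a = 'a] assms(3-5) by blast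
  \<comment> \<open>Degree 0 gives the properness required for existence, and degree 1 gives the
    absence of linear terms required by \<open>choose_le_rank\<close>.\<close>
  have low: "Poly_Mapping.lookup p m = 0" if "p \<in> J" "mdeg m < 2" for p m
  proof -
    have "\<not> P m" using P(3)[of m] that(2) by auto
    then have "m \<notin> Poly_Mapping.keys p" using that(1) P(1) by auto
    then show ?thesis by (simp add: in_keys_iff)
  qed
  obtain xs where xs: "set xs = ?V" "distinct xs"
    using crystal_carrier(1) finite_distinct_list assms(3) by blast
  define F where "F = the_resolution ?V J"
  define rk where "rk i = length (shifts F i)" for i
  have "\<exists>F. minimal_graded_free_resolution ?V J F"
    using crystal_carrier(1) assms(3) low graded_submodule_monomial_ideal[OF P(1,2)]
    by (intro minimal_graded_free_resolution_exists) (auto simp: mdeg_eq_0_iff[THEN iffD2])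
  then have "minimal_graded_free_resolution (set xs) J F"
    unfolding F_def the_resolution_def xs(1) by (rule someI_ex)
  note F = minimal_graded_free_resolution_complex[OF this xs(2), folded rk_def]
  interpret minimal_exact_complex xs rk "\<lambda>i r c. boundary F i $$ (r, c)" by (rule F(1))
  have high: "rk i = 0" if "i > (\<Sum>i = 1..k. n i) + 2" for i
    using crystal_carrier(2)[of k n] that distinct_card[OF xs(2)] assms(3) xs(1)
    by (intro rank_eq_0) simp
  have betti: "n i choose q \<le> rk q" if "i \<in> {1..k}" "q > 0" for i q
  proof -
    \<comment> \<open>The first element of some other chain will be the variable \<open>y\<close> of
      \<open>choose_le_rank\<close>.\<close>
    obtain j where j: "j \<in> {1..k}" "j \<noteq> i" using assms(1) by (cases "i = 1") (auto intro: that[of 1] that[of 2])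
    have y: "Cx j 1 \<in> ?V" using j assms(2)[of j] by (auto simp: assms(3) crystal_lattice_def)
    let ?Y = "Cx i ` {1..n i}"
    have Y: "?Y \<subseteq> ?V" using that by (auto simp: assms(3) crystal_lattice_def)
    have "card ?Y choose q \<le> rk q"
    proof (rule choose_le_rank)
      show "var x * var (Cx j 1) \<in> augmentation_ideal" if "x \<in> ?Y" for x
        using that Y y j crystal_initial_ideal(2)[of i _ k n j 1, where 'a = 'a] assms(3-5) F(2) by auto
      show "Poly_Mapping.lookup p (Poly_Mapping.single x 1) = 0" if "p \<in> augmentation_ideal" for p x
        using that low[of p "Poly_Mapping.single x 1"] F(2) by (simp add: mdeg_single)
    qed (use j y Y xs that F(3) in auto)
    moreover have "card ?Y = n i" by (simp add: card_image inj_on_def)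
    ultimately show ?thesis by simp
  qed
  have "Max (n ` {1..k}) \<in> n ` {1..k}" using assms(1) by (intro Max_in) auto
  then obtain i where i: "i \<in> {1..k}" "Max (n ` {1..k}) = n i" by auto
  \<comment> \<open>With \<open>q = n i\<close> the binomial coefficient is 1, so the term at the
    length of the longest chain is nonzero.\<close>
  then have "shifts F (n i) \<noteq> []" using betti[of i "n i"] assms(2)[of i] by (auto simp: rk_def)
  then have "enat (n i) \<le> proj_dim ?V J" unfolding proj_dim_def F_def by (intro Sup_upper) blast
  moreover have "proj_dim ?V J \<le> enat ((\<Sum>i = 1..k. n i) + 2)"
    unfolding proj_dim_def
  proof (rule Sup_least)
    fix e assume "e \<in> {enat i | i. shifts (the_resolution ?V J) i \<noteq> []}"
    then obtain i where i: "e = enat i" "rk i \<noteq> 0" by (auto simp: rk_def F_def)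
    then show "e \<le> enat ((\<Sum>i = 1..k. n i) + 2)" using high[of i] by (cases "i \<le> (\<Sum>i = 1..k. n i) + 2") auto
  qed
  moreover have "n 1 choose i \<le> suminf (graded_betti ?V J i)" if "i \<in> {1..n 1}" for i
    using betti[of 1 i] that assms(1) by (simp add: suminf_graded_betti rk_def F_def)
  ultimately show ?thesis using i by simp
qed

end
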